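(* Let $(V,\omega)$ be a simple VOA of strong CFT type over $\mathbb{K}$. Then the natural map of orbit sets $(V_2\cap CV_{CFT})/\mathrm{Aut}_\omega V\to CV_{CFT}/\mathrm{Aut}\,V$, induced by the inclusion $V_2\cap CV_{CFT}\subset CV_{CFT}$, is a bijection.
   Context: The base field $\mathbb{K}$ is $\mathbb{R}$ or $\mathbb{C}$. For a vertex algebra $V$ over $\mathbb{K}$ with vacuum vector $\mathbf{1}$, $a(n)b$ denotes the $n$-th product ($n\in\mathbb{Z}$), $a(n)\in\mathrm{End}\,V$, and $Ta=a(-2)\mathbf{1}$. A $\mathbb{Z}$-graded vertex algebra is a vertex algebra $V=\bigoplus_{n\in\mathbb{Z}}V_n$ with $V_n(k)V_m\subset V_{n+m-k-1}$ and $\mathbf{1}\in V_0$. A $\mathbb{Z}$-graded conformal vertex algebra $(V,\omega)$ is a $\mathbb{Z}$-graded vertex algebra with a distinguished $\omega\in V_2$ such that the operators $L(n)=\omega(n+1)$ satisfy $[L(n),L(m)]=(n-m)L(n+m)+\frac{1}{12}\delta_{n+m,0}(n^3-n)c$ for some $c\in\mathbb{K}$, $L(0)v=nv$ for $v\in V_n$, and $L(-1)=T$. It is a VOA of CFT type if $V=\bigoplus_{n\in\mathbb{N}}V_n$ (with $\mathbb{N}=\{0,1,2,\dots\}$), $\dim V_n<\infty$ for all $n$, and $V_0=\mathbb{K}\mathbf{1}$. It is a VOA of strong CFT type if moreover $L(1)V_1=0$. Simple means that $V$ has no nontrivial proper ideals. $\mathrm{Aut}\,V$ is the group of vertex algebra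 automorphisms of $V$: linear isomorphisms $f$ with $f(a(n)b)=f(a)(n)f(b)$ for all $a,b,n$ and $f(\mathbf{1})=\mathbf{1}$; $\mathrm{Aut}_\omega V=\{f\in\mathrm{Aut}\,V\mid f(\omega)=\omega\}$. $CV_{CFT}$ is the set of conformal vectors of CFT type of $V$, i.e. of $a\in V$ such that $(V,a)$, with grading $V=\bigoplus_n V_n^a$, $V_n^a=\{v\in V\mid a(1)v=nv\}$, is a VOA of CFT type. $V_2$ is the degree-2 space for the grading given by $\omega$. The group $\mathrm{Aut}\,V$ acts on $CV_{CFT}$, and $\mathrm{Aut}_\omega V$ preserves the grading $V=\bigoplus_n V_n$ and so acts on $V_2\cap CV_{CFT}$. *)

theory Defs
  imports
    Complex_Main
    "HOL-Library.Groups_Big_Fun"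
    "HOL-Algebra.Group_Action"
begin

section \<open>Vertex algebras\<close>

text \<open>
  The carrier is the type \<open>'v\<close>, and \<open>prd a n b\<close> is the \<open>n\<close>-th product \<open>a(n)b\<close>. All sums in the
  Borcherds identity are finite by truncation, so \<^const>\<open>Sum_any\<close> (the sum over the support) gives
  their value.
\<close>

locale vertex_algebra = vector_space scale
  for scale :: "'k::field_char_0 \<Rightarrow> 'v::ab_group_add \<Rightarrow> 'v"  (infixr \<open>*s\<close> 75) +
  fixes prd :: "'v \<Rightarrow> int \<Rightarrow> 'v \<Rightarrow> 'v"
    and vac :: 'v
  assumes linear_right: "Vector_Spaces.linear scale scale (\<lambda>b. prd a n b)"
    and linear_left: "Vector_Spaces.linear scale scale (\<lambda>a. prd a n b)"
    and truncation: "\<exists>N. \<forall>n\<ge>N. prd a n b = 0"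
    and vacuum_left: "prd vac n a = (if n = -1 then a else 0)"
    and vacuum_right: "n \<ge> 0 \<Longrightarrow> prd a n vac = 0"
    and creation: "prd a (-1) vac = a"
    and Borcherds_identity:
      "Sum_any (\<lambda>i::nat. (of_int p gchoose i) *s prd (prd a (r + int i) b) (p + q - int i) c)
       = Sum_any (\<lambda>i::nat. ((-1) ^ i * (of_int r gchoose i)) *s
           (prd a (p + r - int i) (prd b (q + int i) c)
            - ((-1) powi r) *s prd b (q + r - int i) (prd a (p + int i) c)))"
begin

definition T :: "'v \<Rightarrow> 'v" where
  "T a = prd a (-2) vac"

definition ideal :: "'v set \<Rightarrow> bool" where
  "ideal I \<longleftrightarrow> subspace I \<and> (\<forall>a n. \<forall>v\<in>I. prd a n v \<in> I \<and> prd v n a \<in> I)"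

definition simple :: bool where
  "simple \<longleftrightarrow> (\<forall>I. ideal I \<longrightarrow> I = {0} \<or> I = UNIV)"

definition Aut :: "('v \<Rightarrow> 'v) monoid" where
  "Aut = \<lparr>carrier = {f. Vector_Spaces.linear scale scale f \<and> bij f
                       \<and> (\<forall>a n b. f (prd a n b) = prd (f a) n (f b)) \<and> f vac = vac},
          mult = (\<circ>), one = id\<rparr>"

definition Aut_fixing :: "'v \<Rightarrow> ('v \<Rightarrow> 'v) monoid" where
  "Aut_fixing \<omega> = Aut\<lparr>carrier := {f \<in> carrier Aut. f \<omega> = \<omega>}\<rparr>"

end

definition (in vector_space) direct_sum_decomposition :: "(int \<Rightarrow> 'b set) \<Rightarrow> bool" where
  "direct_sum_decomposition G \<longleftrightarrow> (\<forall>n. subspace (G n)) \<and>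
     (\<forall>v. \<exists>!x. (\<forall>n. x n \<in> G n) \<and> finite {n. x n \<noteq> 0} \<and> v = Sum_any x)"


section \<open>Conformal vertex algebras\<close>

locale graded_vertex_algebra = vertex_algebra scale prd vac
  for scale :: "'k::field_char_0 \<Rightarrow> 'v::ab_group_add \<Rightarrow> 'v"  (infixr \<open>*s\<close> 75)
    and prd vac +
  fixes G :: "int \<Rightarrow> 'v set"
  assumes direct_sum: "direct_sum_decomposition G"
    and prd_degree: "a \<in> G n \<Longrightarrow> b \<in> G m \<Longrightarrow> prd a k b \<in> G (n + m - k - 1)"
    and vac_degree: "vac \<in> G 0"

locale conformal_vertex_algebra = graded_vertex_algebra scale prd vac G
  for scale :: "'k::field_char_0 \<Rightarrow> 'v::ab_group_add \<Rightarrow> 'v"  (infixr \<open>*s\<close> 75)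
    and prd vac G +
  fixes \<omega> :: 'v
  assumes omega_degree: "\<omega> \<in> G 2"
    and Virasoro: "\<exists>c::'k. \<forall>n m v.
      prd \<omega> (n + 1) (prd \<omega> (m + 1) v) - prd \<omega> (m + 1) (prd \<omega> (n + 1) v)
      = of_int (n - m) *s prd \<omega> (n + m + 1) v
        + (if n + m = 0 then (of_int (n ^ 3 - n) * c / 12) *s v else 0)"
    and L0_degree: "v \<in> G n \<Longrightarrow> prd \<omega> 1 v = of_int n *s v"
    and L_minus_1: "prd \<omega> 0 v = T v"
begin

definition L :: "int \<Rightarrow> 'v \<Rightarrow> 'v" where
  "L n v = prd \<omega> (n + 1) v"

end

locale CFT_type_voa = conformal_vertex_algebra scale prd vac G \<omega>
  for scale :: "'k::field_char_0 \<Rightarrow> 'v::ab_group_add \<Rightarrow> 'v"  (infixr \<open>*s\<close> 75)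
    and prd vac G \<omega> +
  assumes degree_nonneg: "n < 0 \<Longrightarrow> G n = {0}"
    and finite_dimensional: "\<exists>B. finite B \<and> span B = G n"
    and degree_0: "G 0 = span {vac}"

locale strong_CFT_type_voa = CFT_type_voa scale prd vac G \<omega>
  for scale :: "'k::field_char_0 \<Rightarrow> 'v::ab_group_add \<Rightarrow> 'v"  (infixr \<open>*s\<close> 75)
    and prd vac G \<omega> +
  assumes L1_degree_1: "v \<in> G 1 \<Longrightarrow> L 1 v = 0"


section \<open>Conformal vectors of CFT type and their orbits\<close>

context vertex_algebra
begin

definition weight_space :: "'v \<Rightarrow> int \<Rightarrow> 'v set" where
  "weight_space a n = {v. prd a 1 v = of_int n *s v}"

definition CV_CFT :: "'v set" where
  "CV_CFT = {a. CFT_type_voa scale prd vac (weight_space a) a}"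

end

text \<open>
  The evaluation action on \<open>E\<close> of a group of permutations preserving \<open>E\<close>; the restriction makes
  the maps extensional, as \<^const>\<open>group_action\<close> requires.
\<close>

definition evaluation_action :: "'a set \<Rightarrow> ('a \<Rightarrow> 'a) \<Rightarrow> 'a \<Rightarrow> 'a" where
  "evaluation_action E f = restrict f E"

text \<open>
  For sets \<open>D \<subseteq> E\<close> with compatible actions, the map on orbits induced by the inclusion sends an
  orbit \<open>X\<close> in \<open>D\<close> to the common orbit in \<open>E\<close> of the elements of \<open>X\<close>; the union over the
  representatives is that common orbit.
\<close>

definition induced_orbit_map :: "('g, 'm) monoid_scheme \<Rightarrow> ('g \<Rightarrow> 'a \<Rightarrow> 'a) \<Rightarrow> 'a set \<Rightarrow> 'a set" where
  "induced_orbit_map H \<phi> X = (\<Union>a\<in>X. orbit H \<phi> a)"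


subsection \<open>The actions and the induced map are well defined\<close>

context vertex_algebra
begin

lemma AutD:
  assumes "f \<in> carrier Aut"
  shows "f (x + y) = f x + f y" "f (c *s x) = c *s f x" "bij f"
    "f (prd a n b) = prd (f a) n (f b)" "f vac = vac" "f 0 = 0" "f (x - y) = f x - f y"
    "Vector_Spaces.linear scale scale f"
proof -
  have lin: "Vector_Spaces.linear scale scale f" using assms by (simp add: Aut_def)
  interpret f: Vector_Spaces.linear scale scale f by (rule lin)
  show "f (x + y) = f x + f y" "f (c *s x) = c *s f x" "f 0 = 0" "f (x - y) = f x - f y"
    by (simp_all add: f.add f.scale f.zero f.diff)
  show "bij f" "f (prd a n b) = prd (f a) n (f b)" "f vac = vac"
    using assms by (simp_all add: Aut_def)
qed (use assms in \<open>simp add: Aut_def\<close>)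

lemma linear_iff': "Vector_Spaces.linear scale scale f \<longleftrightarrow>
    (\<forall>x y. f (x + y) = f x + f y) \<and> (\<forall>c x. f (c *s x) = c *s f x)"
  using vector_space_axioms by (simp add: Vector_Spaces.linear_iff)

lemma inv_Aut:
  assumes f: "f \<in> carrier Aut"
  shows "inv_into UNIV f \<in> carrier Aut"
proof -
  let ?g = "inv_into UNIV f"
  note F = AutD[OF f]
  have fg: "f (?g x) = x" for x using F(3) by (simp add: bij_def surj_f_inv_f)
  have eq: "?g y = x" if "y = f x" for x y using F(3) that by (simp add: bij_def)
  have "bij ?g" using F(3) by (rule bij_imp_bij_inv)
  moreover have "?g (x + y) = ?g x + ?g y" for x y by (rule eq) (simp add: F(1) fg)
  moreover have "?g (c *s x) = c *s ?g x" for c x by (rule eq) (simp add: F(2) fg)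
  moreover have "?g (prd a n b) = prd (?g a) n (?g b)" for a n b by (rule eq) (simp add: F(4) fg)
  moreover have "?g vac = vac" by (rule eq) (simp add: F(5))
  ultimately show ?thesis by (simp add: Aut_def linear_iff')
qed

lemma group_Aut: "group Aut"
proof (rule groupI)
  fix f g assume "f \<in> carrier Aut" "g \<in> carrier Aut"
  then show "f \<otimes>\<^bsub>Aut\<^esub> g \<in> carrier Aut"
    by (auto simp: Aut_def linear_iff' intro: bij_comp)
next
  show "\<one>\<^bsub>Aut\<^esub> \<in> carrier Aut" by (simp add: Aut_def linear_iff')
next
  fix f assume f: "f \<in> carrier Aut"
  have "inv_into UNIV f \<otimes>\<^bsub>Aut\<^esub> f = \<one>\<^bsub>Aut\<^esub>"
    using AutD(3)[OF f] by (auto simp: Aut_def bij_def fun_eq_iff)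
  then show "\<exists>g\<in>carrier Aut. g \<otimes>\<^bsub>Aut\<^esub> f = \<one>\<^bsub>Aut\<^esub>"
    using inv_Aut[OF f] by blast
qed (auto simp: Aut_def)

lemma group_Aut_fixing: "group (Aut_fixing \<omega>)"
proof (rule groupI)
  fix f g assume "f \<in> carrier (Aut_fixing \<omega>)" "g \<in> carrier (Aut_fixing \<omega>)"
  then show "f \<otimes>\<^bsub>Aut_fixing \<omega>\<^esub> g \<in> carrier (Aut_fixing \<omega>)"
    by (auto simp: Aut_fixing_def Aut_def linear_iff' intro: bij_comp)
next
  show "\<one>\<^bsub>Aut_fixing \<omega>\<^esub> \<in> carrier (Aut_fixing \<omega>)"
    by (simp add: Aut_fixing_def Aut_def linear_iff')
next
  fix f assume f: "f \<in> carrier (Aut_fixing \<omega>)"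
  then have fA: "f \<in> carrier Aut" and fw: "f \<omega> = \<omega>" by (auto simp: Aut_fixing_def)
  have "inv_into UNIV f \<omega> = \<omega>" using AutD(3)[OF fA] fw by (metis bij_inv_eq_iff)
  moreover have "inv_into UNIV f \<otimes>\<^bsub>Aut_fixing \<omega>\<^esub> f = \<one>\<^bsub>Aut_fixing \<omega>\<^esub>"
    using AutD(3)[OF fA] by (auto simp: Aut_fixing_def Aut_def bij_def fun_eq_iff)
  ultimately show "\<exists>g\<in>carrier (Aut_fixing \<omega>). g \<otimes>\<^bsub>Aut_fixing \<omega>\<^esub> f = \<one>\<^bsub>Aut_fixing \<omega>\<^esub>"
    using inv_Aut[OF fA] by (intro bexI[of _ "inv_into UNIV f"]) (auto simp: Aut_fixing_def)
qed (auto simp: Aut_fixing_def Aut_def)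

lemma image_weight_space:
  assumes f: "f \<in> carrier Aut"
  shows "f ` weight_space a n = weight_space (f a) n"
proof
  show "f ` weight_space a n \<subseteq> weight_space (f a) n"
    by (auto simp: weight_space_def AutD(2)[OF f] simp flip: AutD(4)[OF f])
  show "weight_space (f a) n \<subseteq> f ` weight_space a n"
  proof
    fix v assume v: "v \<in> weight_space (f a) n"
    obtain w where w: "v = f w" using AutD(3)[OF f] by (meson bij_pointE)
    from v have "f (prd a 1 w) = f (of_int n *s w)"
      by (simp add: weight_space_def w AutD[OF f])
    then have "prd a 1 w = of_int n *s w" using AutD(3)[OF f] by (simp add: bij_def inj_eq)
    then show "v \<in> f ` weight_space a n" by (auto simp: weight_space_def w)
  qed
qed

lemma image_direct_sum:
  assumes f: "f \<in> carrier Aut" and G: "direct_sum_decomposition G"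
  shows "direct_sum_decomposition (\<lambda>n. f ` G n)"
  unfolding direct_sum_decomposition_def
proof (intro conjI allI)
  interpret f: Vector_Spaces.linear scale scale f by (rule AutD(8)[OF f])
  fix n show "subspace (f ` G n)"
    using G by (auto simp: direct_sum_decomposition_def intro!: f.subspace_image)
next
  let ?g = "inv_into UNIV f"
  have g: "?g \<in> carrier Aut" by (rule inv_Aut[OF f])
  have fg: "f (?g x) = x" and gf: "?g (f x) = x" for x
    using AutD(3)[OF f] by (simp_all add: bij_def surj_f_inv_f)
  have zf: "f v = 0 \<longleftrightarrow> v = 0" and zg: "?g v = 0 \<longleftrightarrow> v = 0" for v
    by (metis AutD(6)[OF f] gf, metis AutD(6)[OF g] fg)
  have sum_any: "h (Sum_any x) = Sum_any (\<lambda>n. h (x n))"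
    if "h \<in> carrier Aut" "\<And>v. h v = 0 \<longleftrightarrow> v = 0" for h and x :: "int \<Rightarrow> 'v"
  proof -
    interpret h: Vector_Spaces.linear scale scale h by (rule AutD(8)[OF that(1)])
    show ?thesis by (simp add: Sum_any.expand_set h.sum that(2))
  qed
  fix v
  from G have ex1: "\<exists>!x. (\<forall>n. x n \<in> G n) \<and> finite {n. x n \<noteq> 0} \<and> ?g v = Sum_any x"
    unfolding direct_sum_decomposition_def by blast
  from ex1_implies_ex[OF ex1] obtain x
    where x: "\<forall>n. x n \<in> G n" "finite {n. x n \<noteq> 0}" "?g v = Sum_any x"
    by blast
  have u: "y = x" if "\<forall>n. y n \<in> G n" "finite {n. y n \<noteq> 0}" "?g v = Sum_any y" for y
    using ex1 x that unfolding Ex1_def by blast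
  show "\<exists>!x. (\<forall>n. x n \<in> f ` G n) \<and> finite {n. x n \<noteq> 0} \<and> v = Sum_any x"
  proof (rule ex1I[of _ "\<lambda>n. f (x n)"], intro conjI)
    show "\<forall>n. f (x n) \<in> f ` G n" using x by blast
    show "finite {n. f (x n) \<noteq> 0}" using x zf by simp
    show "v = Sum_any (\<lambda>n. f (x n))" using sum_any[OF f zf, of x] fg[of v] by (simp add: x(3))
  next
    fix y assume y: "(\<forall>n. y n \<in> f ` G n) \<and> finite {n. y n \<noteq> 0} \<and> v = Sum_any y"
    have "(\<lambda>n. ?g (y n)) = x"
    proof (rule u)
      show "\<forall>n. ?g (y n) \<in> G n" using y gf by (metis imageE)
      show "finite {n. ?g (y n) \<noteq> 0}" using y by (simp add: zg)
      show "?g v = Sum_any (\<lambda>n. ?g (y n))" using y sum_any[OF g zg, of y] by simp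
    qed
    then show "y = (\<lambda>n. f (x n))" by (auto simp: fg)
  qed
qed

lemma image_CFT_type_voa:
  assumes f: "f \<in> carrier Aut" and "CFT_type_voa scale prd vac G \<omega>"
  shows "CFT_type_voa scale prd vac (\<lambda>n. f ` G n) (f \<omega>)"
proof -
  interpret A: CFT_type_voa scale prd vac G \<omega> by fact
  interpret f: Vector_Spaces.linear scale scale f by (rule AutD(8)[OF f])
  have fg: "f (inv_into UNIV f x) = x" for x
    using AutD(3)[OF f] by (simp add: bij_def surj_f_inv_f)
  show ?thesis
  proof
    show "direct_sum_decomposition (\<lambda>n. f ` G n)"
      by (rule image_direct_sum[OF f A.direct_sum])
    show "vac \<in> f ` G 0" using A.vac_degree AutD(5)[OF f] by (metis imageI)
    show "f \<omega> \<in> f ` G 2" using A.omega_degree by blast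
    fix a b n m k assume "a \<in> f ` G n" "b \<in> f ` G m"
    then show "prd a k b \<in> f ` G (n + m - k - 1)"
      using A.prd_degree by (force simp flip: AutD(4)[OF f])
  next
    obtain c :: 'k where c: "\<forall>n m v.
      prd \<omega> (n + 1) (prd \<omega> (m + 1) v) - prd \<omega> (m + 1) (prd \<omega> (n + 1) v)
      = of_int (n - m) *s prd \<omega> (n + m + 1) v
        + (if n + m = 0 then (of_int (n ^ 3 - n) * c / 12) *s v else 0)"
      using A.Virasoro by blast
    have "prd (f \<omega>) (n + 1) (prd (f \<omega>) (m + 1) v) - prd (f \<omega>) (m + 1) (prd (f \<omega>) (n + 1) v)
      = of_int (n - m) *s prd (f \<omega>) (n + m + 1) v
        + (if n + m = 0 then (of_int (n ^ 3 - n) * c / 12) *s v else 0)" for n m v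
    proof -
      obtain w where w: "v = f w" using fg by metis
      have "f (prd \<omega> (n + 1) (prd \<omega> (m + 1) w) - prd \<omega> (m + 1) (prd \<omega> (n + 1) w))
        = f (of_int (n - m) *s prd \<omega> (n + m + 1) w
          + (if n + m = 0 then (of_int (n ^ 3 - n) * c / 12) *s w else 0))"
        by (rule arg_cong[OF c[rule_format]])
      then show ?thesis
        by (simp add: w AutD(1,2,6,7)[OF f] AutD(4)[OF f] split: if_splits)
    qed
    then show "\<exists>c::'k. \<forall>n m v.
      prd (f \<omega>) (n + 1) (prd (f \<omega>) (m + 1) v) - prd (f \<omega>) (m + 1) (prd (f \<omega>) (n + 1) v)
      = of_int (n - m) *s prd (f \<omega>) (n + m + 1) v
        + (if n + m = 0 then (of_int (n ^ 3 - n) * c / 12) *s v else 0)" by blast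
  next
    fix v n assume "v \<in> f ` G n"
    then show "prd (f \<omega>) 1 v = of_int n *s v"
      by (auto simp: A.L0_degree AutD(2)[OF f] simp flip: AutD(4)[OF f])
  next
    fix v
    obtain w where w: "v = f w" using fg by metis
    have "f (prd \<omega> 0 w) = f (T w)" by (simp add: A.L_minus_1)
    then show "prd (f \<omega>) 0 v = T v" by (simp add: w T_def AutD(4,5)[OF f])
  next
    fix n :: int assume "n < 0"
    then show "f ` G n = {0}" by (simp add: A.degree_nonneg AutD(6)[OF f])
  next
    fix n
    obtain B where "finite B" "span B = G n" using A.finite_dimensional by blast
    then show "\<exists>B. finite B \<and> span B = f ` G n"
      by (intro exI[of _ "f ` B"]) (simp add: f.span_image)
  next
    show "f ` G 0 = span {vac}"
      using f.span_image[of "{vac}"] by (simp add: A.degree_0 AutD(5)[OF f])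
  qed
qed

lemma CV_CFT_Aut:
  assumes "f \<in> carrier Aut" "a \<in> CV_CFT"
  shows "f a \<in> CV_CFT"
  using image_CFT_type_voa[OF assms(1), of "weight_space a" a] assms
  by (simp add: CV_CFT_def image_weight_space)

end

lemma (in conformal_vertex_algebra) weight_space_omega: "weight_space \<omega> n = G n"
proof
  show "G n \<subseteq> weight_space \<omega> n" using L0_degree by (auto simp: weight_space_def)
  show "weight_space \<omega> n \<subseteq> G n"
  proof
    fix v assume v: "v \<in> weight_space \<omega> n"
    have sub: "subspace (G m)" for m using direct_sum by (simp add: direct_sum_decomposition_def)
    from direct_sum have ex1: "\<exists>!x. (\<forall>m. x m \<in> G m) \<and> finite {m. x m \<noteq> 0} \<and> w = Sum_any x" for w
      unfolding direct_sum_decomposition_def by blast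
    from ex1[of v] obtain x where x: "\<forall>m. x m \<in> G m" "finite {m. x m \<noteq> 0}" "v = Sum_any x" by blast
    interpret l: Vector_Spaces.linear scale scale "\<lambda>b. prd \<omega> 1 b" by (rule linear_right)
    define S where "S = {m. x m \<noteq> 0}"
    have vS: "v = (\<Sum>m\<in>S. x m)" using x by (simp add: Sum_any.expand_set S_def)
    define y where "y m = of_int n *s x m" for m
    define z where "z m = of_int m *s x m" for m
    have sup: "{m. y m \<noteq> 0} \<subseteq> S" "{m. z m \<noteq> 0} \<subseteq> S" by (auto simp: S_def y_def z_def)
    have fS: "finite S" using x by (simp add: S_def)
    have sy: "of_int n *s v = Sum_any y"
      using Sum_any.expand_superset[OF fS sup(1)] by (simp add: vS y_def scale_sum_right)
    have sz: "prd \<omega> 1 v = Sum_any z"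
    proof -
      have "prd \<omega> 1 v = (\<Sum>m\<in>S. prd \<omega> 1 (x m))" unfolding vS by (rule l.sum)
      also have "\<dots> = (\<Sum>m\<in>S. z m)" using x(1) by (intro sum.cong) (simp_all add: z_def L0_degree)
      also have "\<dots> = Sum_any z" using Sum_any.expand_superset[OF fS sup(2)] by simp
      finally show ?thesis .
    qed
    have "Sum_any z = Sum_any y" using sy sz v by (simp add: weight_space_def)
    moreover have "\<forall>m. y m \<in> G m" "\<forall>m. z m \<in> G m"
      using x(1) sub by (auto simp: y_def z_def subspace_scale)
    moreover have "finite {m. y m \<noteq> 0}" "finite {m. z m \<noteq> 0}"
      using fS sup finite_subset by blast+
    ultimately have "y = z" using ex1[of "Sum_any y"] by metis
    then have "x m = 0" if "m \<noteq> n" for m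
      using that by (auto simp: y_def z_def fun_eq_iff)
    then have "S \<subseteq> {n}" by (auto simp: S_def)
    then have "v = x n \<or> v = 0" by (auto simp: vS subset_singleton_iff)
    then show "v \<in> G n" using x(1) sub subspace_0 by auto
  qed
qed

lemma evaluation_group_action:
  fixes H :: "('a \<Rightarrow> 'a) monoid"
  assumes H: "group H" "mult H = (\<circ>)"
    and inj: "\<And>f. f \<in> carrier H \<Longrightarrow> inj f" and pres: "\<And>f x. \<lbrakk>f \<in> carrier H; x \<in> E\<rbrakk> \<Longrightarrow> f x \<in> E"
    and one: "one H = id"
  shows "group_action H E (evaluation_action E)"
proof -
  interpret group H by fact
  have bij: "evaluation_action E f \<in> Bij E" if f: "f \<in> carrier H" for f
  proof -
    have "f (m_inv H f x) = x" for x
      using r_inv[OF f] by (simp add: H one fun_eq_iff)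
    moreover have "m_inv H f x \<in> E" if "x \<in> E" for x using pres that f by simp
    ultimately have "E \<subseteq> f ` E" by (metis image_eqI subsetI)
    then have "f ` E = E" using pres[OF f] by blast
    moreover have "inj_on f E" using inj[OF f] by (meson inj_on_subset subset_UNIV)
    ultimately show ?thesis
      by (simp add: Bij_def evaluation_action_def bij_betw_def inj_on_restrict_eq)
  qed
  have "evaluation_action E \<in> hom H (BijGroup E)"
  proof (rule homI)
    fix f g assume fg: "f \<in> carrier H" "g \<in> carrier H"
    then show "evaluation_action E (f \<otimes>\<^bsub>H\<^esub> g)
        = evaluation_action E f \<otimes>\<^bsub>BijGroup E\<^esub> evaluation_action E g"
      using bij[OF fg(1)] bij[OF fg(2)] pres[OF fg(2)]
      by (simp add: BijGroup_def compose_def evaluation_action_def H(2) restrict_def fun_eq_iff)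
  qed (use bij in \<open>simp add: BijGroup_def\<close>)
  then show ?thesis
    using H(1) by (intro group_action.intro group_hom.intro group_hom_axioms.intro group_BijGroup)
qed

lemma (in vertex_algebra) Aut_action_CV_CFT:
  "group_action Aut CV_CFT (evaluation_action CV_CFT)"
  by (rule evaluation_group_action)
    (use group_Aut CV_CFT_Aut AutD(3) in \<open>auto simp: Aut_def bij_def\<close>)

lemma (in conformal_vertex_algebra) Aut_fixing_action:
  "group_action (Aut_fixing \<omega>) (G 2 \<inter> CV_CFT) (evaluation_action (G 2 \<inter> CV_CFT))"
proof (rule evaluation_group_action)
  fix f x assume "f \<in> carrier (Aut_fixing \<omega>)" "x \<in> G 2 \<inter> CV_CFT"
  then show "f x \<in> G 2 \<inter> CV_CFT"
    using CV_CFT_Aut image_weight_space[of f \<omega> 2] by (auto simp: Aut_fixing_def weight_space_omega)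
qed (use group_Aut_fixing AutD(3) in \<open>auto simp: Aut_fixing_def Aut_def bij_def\<close>)

lemma (in conformal_vertex_algebra) induced_orbit_map_orbit:
  assumes "a \<in> G 2 \<inter> CV_CFT"
  shows "induced_orbit_map Aut (evaluation_action CV_CFT)
           (orbit (Aut_fixing \<omega>) (evaluation_action (G 2 \<inter> CV_CFT)) a)
         = orbit Aut (evaluation_action CV_CFT) a"
proof -
  interpret A: group Aut by (rule group_Aut)
  let ?X = "orbit (Aut_fixing \<omega>) (evaluation_action (G 2 \<inter> CV_CFT)) a"
  have X: "?X = {f a | f. f \<in> carrier (Aut_fixing \<omega>)}"
    using assms by (simp add: orbit_def evaluation_action_def)
  have orb: "orbit Aut (evaluation_action CV_CFT) b = {f b | f. f \<in> carrier Aut}"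
    if "b \<in> CV_CFT" for b using that by (simp add: orbit_def evaluation_action_def)
  have ca: "a \<in> CV_CFT" using assms by simp
  have aX: "a \<in> ?X"
  proof -
    have "id \<in> carrier (Aut_fixing \<omega>)"
      using group.is_monoid[OF group_Aut_fixing[of \<omega>], THEN monoid.one_closed]
      by (simp add: Aut_fixing_def Aut_def)
    then show ?thesis unfolding X by (intro CollectI exI[of _ id]) simp
  qed
  have "orbit Aut (evaluation_action CV_CFT) b \<subseteq> orbit Aut (evaluation_action CV_CFT) a"
    if "b \<in> ?X" for b
  proof -
    from that obtain f where f: "f \<in> carrier Aut" "b = f a" unfolding X by (auto simp: Aut_fixing_def)
    have "\<exists>h. g (f a) = h a \<and> h \<in> carrier Aut" if "g \<in> carrier Aut" for g
      using A.m_closed[OF that f(1)] by (intro exI[of _ "g \<circ> f"]) (simp add: Aut_def)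
    then show ?thesis using orb[OF ca] orb[OF CV_CFT_Aut[OF f(1) ca]] f(2) by auto
  qed
  then show ?thesis using aX unfolding induced_orbit_map_def by blast
qed

end

theory Submission
  imports Defs
begin

text \<open>
  Everything works over any field of characteristic zero, and both claims about orbits come from
  comparing the grading of \<open>\<omega>\<close> with the grading by eigenvalues of \<open>a(1)\<close> for another conformal
  vector \<open>a\<close> of CFT type. Since \<open>a(0) = T = \<omega>(0)\<close>, the difference \<open>x = a - \<omega>\<close> has \<open>x(0) = 0\<close>.
  Skew symmetry applied to \<open>x(0)\<omega> = 0\<close>, together with \<open>Ker T = K\<one>\<close>, gives \<open>a = \<omega> + c\<one> + h + T z\<close>
  with \<open>h\<close> of weight one and \<open>h(0) = 0\<close> (\<open>component_CV_CFT_difference\<close>). Then \<open>h(1)\<close> is a locally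
  nilpotent derivation with \<open>h(1)\<omega> = h\<close>, and \<open>exp (- h(1))\<close> is an automorphism that removes the
  weight one component of \<open>a\<close> (\<open>ex_Aut_component_1_zero\<close>).

  Now suppose that \<open>h = 0\<close>, and let \<open>b\<close> be the component of \<open>a\<close> of weight two. The operator \<open>a(1)\<close>
  respects the decreasing filtration of the grading of \<open>\<omega>\<close> and induces \<open>b(1)\<close> on leading
  components, so \<open>b(1)\<close> is diagonalizable with eigenvalues in the natural numbers, and the
  eigenvalue zero occurs only on the vacuum line. As \<open>a - c\<one> - b\<close> is \<open>T\<close> of a
  sum of vectors of weight at least two, \<open>a - c\<one>\<close> lies in step two of the filtration attached to
  the eigenspaces of \<open>b(1)\<close>. On its \<open>n\<close>-th graded piece \<open>a(1)\<close> acts as \<open>n - e(0)\<close> for a vector \<open>e\<close>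
  such that \<open>e(0)\<close> strictly raises the degree for \<open>\<omega>\<close>; as \<open>a(1)\<close> is diagonalizable, this forces \<open>e(0) = 0\<close>
  and then \<open>e = 0\<close>. So the \<open>n\<close>-th eigenspace of \<open>a(1)\<close> lies in step \<open>n\<close> of the filtration, and
  passing to leading components is a bijection onto the \<open>n\<close>-th eigenspace of \<open>b(1)\<close>. As products
  respect the filtration, these bijections add up to a vertex algebra automorphism, which sends \<open>a\<close>
  to \<open>b\<close> (\<open>ex_Aut_leading\<close>). Thus every orbit meets the weight two space.

  For injectivity let \<open>f a = b\<close> with \<open>a\<close> and \<open>b\<close> of weight two, and let \<open>w = f \<omega>\<close>. Both \<open>\<omega>\<close> and \<open>w\<close>
  have eigenvalue two under \<open>b(1)\<close>, so the weight one component of \<open>w\<close> vanishes and the leading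
  component automorphism \<open>k\<close> for \<open>w\<close> fixes \<open>b\<close>. It sends \<open>w\<close> to some \<open>\<omega> + T u\<close> with \<open>u\<close> of weight
  one, again of strong CFT type. This gives \<open>u(1)v = 0\<close> for all \<open>v\<close> of weight one, and simplicity
  yields \<open>u = 0\<close> (\<open>weight_one_form_nondegenerate\<close>), because the ideal generated by \<open>u\<close>
  has no component in degree zero and hence is proper. So \<open>k \<circ> f\<close> fixes \<open>\<omega>\<close> and sends \<open>a\<close> to \<open>b\<close>.
\<close>


section \<open>Components and filtrations of a direct sum decomposition\<close>

text \<open>
  The component of \<open>v\<close> in each degree, for a decomposition \<open>G\<close> of the whole space. The value is
  meaningful only if \<open>G\<close> satisfies \<^const>\<open>vector_space.direct_sum_decomposition\<close>.
\<close>

definition (in vector_space) component :: "(int \<Rightarrow> 'b set) \<Rightarrow> 'b \<Rightarrow> int \<Rightarrow> 'b" where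
  "component G v = (THE x. (\<forall>n. x n \<in> G n) \<and> finite {n. x n \<noteq> 0} \<and> v = Sum_any x)"

text \<open>
  The decreasing filtration attached to a decomposition: step \<open>n\<close> consists of the vectors without
  components of degree less than \<open>n\<close>.
\<close>

definition (in vector_space) filtration :: "(int \<Rightarrow> 'b set) \<Rightarrow> int \<Rightarrow> 'b set" where
  "filtration G n = {v. \<forall>k<n. component G v k = 0}"

context vector_space
begin

context
  fixes G :: "int \<Rightarrow> 'b set"
  assumes G: "direct_sum_decomposition G"
begin

lemma subspace_summand: "subspace (G n)"
  using G by (simp add: direct_sum_decomposition_def)

lemma component_ex1: "\<exists>!x. (\<forall>n. x n \<in> G n) \<and> finite {n. x n \<noteq> 0} \<and> v = Sum_any x"
  using G unfolding direct_sum_decomposition_def by blast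

lemma component_mem: "component G v n \<in> G n"
  and finite_component: "finite {n. component G v n \<noteq> 0}"
  and Sum_any_component: "v = Sum_any (component G v)"
  using theI'[OF component_ex1[of v]] by (auto simp: component_def)

lemma component_unique:
  assumes "\<And>n. x n \<in> G n" "finite {n. x n \<noteq> 0}" "v = Sum_any x"
  shows "component G v = x"
  unfolding component_def by (rule the1_equality[OF component_ex1]) (use assms in blast)

lemma sum_component: "v = (\<Sum>n | component G v n \<noteq> 0. component G v n)"
  using Sum_any_component[of v] by (simp add: Sum_any.expand_set)

lemma component_add: "component G (v + w) n = component G v n + component G w n"
proof -
  have "component G (v + w) = (\<lambda>n. component G v n + component G w n)"
  proof (rule component_unique)
    show "finite {n. component G v n + component G w n \<noteq> 0}"
      by (rule finite_subset[OF _ finite_UnI[OF finite_component[of v] finite_component[of w]]]) auto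
    show "v + w = (\<Sum>n. component G v n + component G w n)"
      using Sum_any.distrib[OF finite_component[of v] finite_component[of w]]
      by (simp flip: Sum_any_component)
  qed (simp add: component_mem subspace_add subspace_summand)
  then show ?thesis by simp
qed

lemma component_scale: "component G (c *s v) n = c *s component G v n"
proof -
  have "component G (c *s v) = (\<lambda>n. c *s component G v n)"
  proof (rule component_unique)
    show "finite {n. c *s component G v n \<noteq> 0}"
      by (rule finite_subset[OF _ finite_component[of v]]) auto
    have "c *s v = (\<Sum>n | component G v n \<noteq> 0. c *s component G v n)"
      by (subst sum_component) (simp add: scale_sum_right)
    also have "\<dots> = (\<Sum>n. c *s component G v n)"
      by (rule Sum_any.expand_superset[symmetric]) (auto simp: finite_component)
    finally show "c *s v = (\<Sum>n. c *s component G v n)" .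
  qed (simp add: component_mem subspace_scale subspace_summand)
  then show ?thesis by simp
qed

lemma linear_component: "Vector_Spaces.linear scale scale (\<lambda>v. component G v n)"
  using vector_space_axioms by (simp add: Vector_Spaces.linear_iff component_add component_scale)

lemma component_zero [simp]: "component G 0 n = 0"
  using component_scale[of 0 0] by simp

lemma component_diff: "component G (v - w) n = component G v n - component G w n"
  using component_add[of "v - w" w n] by (simp add: algebra_simps)

lemma component_sum: "component G (sum f A) n = (\<Sum>i\<in>A. component G (f i) n)"
proof -
  interpret Vector_Spaces.linear scale scale "\<lambda>v. component G v n" by (rule linear_component)
  show ?thesis by (rule sum)
qed

lemma component_homogeneous:
  assumes "v \<in> G n"
  shows "component G v k = (if k = n then v else 0)"
proof -
  have "component G v = (\<lambda>k. if k = n then v else 0)"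
  proof (rule component_unique)
    have "(\<Sum>k. if k = n then v else 0) = (\<Sum>k\<in>{n}. if k = n then v else 0)"
      by (rule Sum_any.expand_superset) auto
    then show "v = (\<Sum>k. if k = n then v else 0)" by simp
  qed (use assms subspace_summand in \<open>auto simp: subspace_0\<close>)
  then show ?thesis by simp
qed

lemma component_idem: "component G (component G v n) k = (if k = n then component G v n else 0)"
  by (rule component_homogeneous[OF component_mem])

lemma eq_if_components_eq:
  assumes "\<And>n. component G v n = component G w n"
  shows "v = w"
proof -
  have "component G v = component G w" using assms by (rule ext)
  then show ?thesis using Sum_any_component[of v] Sum_any_component[of w] by simp
qed

lemma homogeneous_disjoint: "v \<in> G n \<Longrightarrow> v \<in> G m \<Longrightarrow> n \<noteq> m \<Longrightarrow> v = 0"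
  using component_homogeneous by metis

lemma subspace_filtration: "subspace (filtration G n)"
  by (rule subspaceI) (simp_all add: filtration_def component_add component_scale)

lemma filtration_homogeneous: "v \<in> G m \<Longrightarrow> n \<le> m \<Longrightarrow> v \<in> filtration G n"
  by (simp add: filtration_def component_homogeneous)

lemma filtration_mono: "n \<le> m \<Longrightarrow> filtration G m \<subseteq> filtration G n"
  by (auto simp: filtration_def)

lemma filtration_split:
  assumes "v \<in> filtration G n"
  shows "v - component G v n \<in> filtration G (n + 1)"
  using assms by (auto simp: filtration_def component_diff component_idem)

lemma lowest_component:
  assumes "v \<noteq> 0"
  obtains n where "v \<in> filtration G n" "component G v n \<noteq> 0"
proof -
  let ?S = "{n. component G v n \<noteq> 0}"
  have "?S \<noteq> {}" using assms sum_component[of v] by (metis sum.empty)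
  then have mem: "Min ?S \<in> ?S" by (rule Min_in[OF finite_component])
  show ?thesis
  proof (rule that)
    show "component G v (Min ?S) \<noteq> 0" using mem by blast
    have "k \<notin> ?S" if "k < Min ?S" for k
      using Min_le[OF finite_component[of v], of k] that by (meson leD)
    then show "v \<in> filtration G (Min ?S)" unfolding filtration_def by blast
  qed
qed

lemma component_degree_shift:
  assumes A: "Vector_Spaces.linear scale scale A" and deg: "\<And>n v. v \<in> G n \<Longrightarrow> A v \<in> G (n + d)"
  shows "component G (A v) n = A (component G v (n - d))"
proof -
  interpret A: Vector_Spaces.linear scale scale A by (rule A)
  let ?S = "{m. component G v m \<noteq> 0}"
  have "component G (A v) n = (\<Sum>m\<in>?S. component G (A (component G v m)) n)"
    by (subst sum_component[of v]) (simp add: A.sum component_sum)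
  also have "\<dots> = (\<Sum>m\<in>?S. if m = n - d then A (component G v m) else 0)"
    by (intro sum.cong refl) (auto simp: component_homogeneous[OF deg[OF component_mem]])
  also have "\<dots> = A (component G v (n - d))"
    using A.zero by (simp add: finite_component)
  finally show ?thesis .
qed

end

text \<open>An invariant subspace contains the components of its vectors along distinct eigenvalues.\<close>

lemma sum_eigenvectors_mem_invariant:
  assumes A: "Vector_Spaces.linear scale scale A"
    and ev: "\<And>m. m \<in> M \<Longrightarrow> A (x m) = \<mu> m *s x m" and inj: "inj_on \<mu> M"
    and S: "subspace S" "\<And>v. v \<in> S \<Longrightarrow> A v \<in> S"
    and M: "finite M" and sum: "(\<Sum>m\<in>M. x m) \<in> S" and m: "m \<in> M"
  shows "x m \<in> S"
  using M ev inj sum m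
proof (induction M arbitrary: x m rule: finite_induct)
  case (insert k M)
  interpret A: Vector_Spaces.linear scale scale A by (rule A)
  let ?v = "\<Sum>m\<in>insert k M. x m"
  have "A ?v - \<mu> k *s ?v = (\<Sum>m\<in>insert k M. (\<mu> m - \<mu> k) *s x m)"
    by (simp add: A.sum insert.prems(1) scale_sum_right scale_left_diff_distrib sum_subtractf
        del: sum.insert)
  also have "\<dots> = (\<Sum>m\<in>M. (\<mu> m - \<mu> k) *s x m)"
    using insert.hyps by simp
  finally have "(\<Sum>m\<in>M. (\<mu> m - \<mu> k) *s x m) \<in> S"
    using insert.prems(3) S by (metis subspace_diff subspace_scale)
  moreover have "A ((\<mu> m - \<mu> k) *s x m) = \<mu> m *s ((\<mu> m - \<mu> k) *s x m)" if "m \<in> M" for m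
    using that by (simp add: A.scale insert.prems(1) mult.commute)
  ultimately have "(\<mu> m - \<mu> k) *s x m \<in> S" if "m \<in> M" for m
    using insert.IH[of "\<lambda>m. (\<mu> m - \<mu> k) *s x m"] insert.prems(2) that by simp
  moreover have "\<mu> m - \<mu> k \<noteq> 0" if "m \<in> M" for m
    using that insert by (auto simp: inj_on_def)
  ultimately have xM: "x m \<in> S" if "m \<in> M" for m
    using that S(1) by (metis scale_scale subspace_scale left_inverse scale_one)
  have "x k = ?v - (\<Sum>m\<in>M. x m)" using insert.hyps by simp
  also have "\<dots> \<in> S"
    using insert.prems(3) subspace_sum[OF S(1), of M x] xM by (simp add: S subspace_diff)
  finally show ?case using xM insert.prems(4) by blast
qed simp

lemma component_mem_invariant:
  assumes E: "direct_sum_decomposition E" and A: "Vector_Spaces.linear scale scale A"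
    and ev: "\<And>m v. v \<in> E m \<Longrightarrow> A v = \<mu> m *s v" and inj: "inj \<mu>"
    and S: "subspace S" "\<And>v. v \<in> S \<Longrightarrow> A v \<in> S" and v: "v \<in> S"
  shows "component E v m \<in> S"
proof (cases "component E v m = 0")
  case True
  then show ?thesis by (simp add: subspace_0[OF S(1)])
next
  case False
  let ?M = "{m. component E v m \<noteq> 0}"
  show ?thesis
  proof (rule sum_eigenvectors_mem_invariant[OF A, of ?M "component E v" \<mu> S m])
    show "A (component E v k) = \<mu> k *s component E v k" for k
      by (rule ev[OF component_mem[OF E]])
    show "inj_on \<mu> ?M" using inj by (rule inj_on_subset) simp
    show "(\<Sum>m\<in>?M. component E v m) \<in> S" using sum_component[OF E, of v] v by simp
  qed (use S False finite_component[OF E] in auto)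
qed

text \<open>
  If \<open>A\<close> is diagonalizable and respects the filtration of \<open>G\<close>, then the operator \<open>B\<close> that it
  induces on leading components is diagonalizable on each \<open>G n\<close>.
\<close>

lemma leading_components_eigenvectors:
  assumes G: "direct_sum_decomposition G" and E: "direct_sum_decomposition E"
    and A: "Vector_Spaces.linear scale scale A"
    and ev: "\<And>m v. v \<in> E m \<Longrightarrow> A v = \<mu> m *s v" and inj: "inj \<mu>"
    and fil: "\<And>v. v \<in> filtration G n \<Longrightarrow> A v \<in> filtration G n"
    and lead: "\<And>v. v \<in> filtration G n \<Longrightarrow> component G (A v) n = B (component G v n)"
    and x: "x \<in> G n"
  defines "y m \<equiv> component G (component E x m) n"
  shows "component E x m \<in> filtration G n" "B (y m) = \<mu> m *s y m"
    "x = (\<Sum>m | component E x m \<noteq> 0. y m)"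
proof -
  show fm: "component E x m \<in> filtration G n" for m
    using component_mem_invariant[OF E A ev inj subspace_filtration[OF G] fil]
      filtration_homogeneous[OF G x order.refl] by blast
  show "B (y m) = \<mu> m *s y m"
    using lead[OF fm, of m] ev[OF component_mem[OF E], of x m]
    by (simp add: y_def component_scale[OF G])
  have "x = component G x n" by (simp add: component_homogeneous[OF G x])
  also have "\<dots> = (\<Sum>m | component E x m \<noteq> 0. y m)"
    by (subst sum_component[OF E, of x]) (simp add: component_sum[OF G] y_def)
  finally show "x = (\<Sum>m | component E x m \<noteq> 0. y m)" .
qed

lemma direct_sum_eigenspaces:
  assumes A: "Vector_Spaces.linear scale scale A" and inj: "inj \<mu>"
    and span: "\<And>v. v \<in> span (\<Union>m. {v. A v = \<mu> m *s v})"
  shows "direct_sum_decomposition (\<lambda>m. {v. A v = \<mu> m *s v})"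
proof -
  interpret A: Vector_Spaces.linear scale scale A by (rule A)
  let ?E = "\<lambda>m::int. {v. A v = \<mu> m *s v}"
  have sub: "subspace (?E m)" for m
    by (rule subspaceI) (simp_all add: A.add A.scale A.zero scale_right_distrib scale_left_commute)
  show ?thesis
    unfolding direct_sum_decomposition_def
  proof (intro conjI allI sub)
    fix v
    let ?P = "\<lambda>v x. (\<forall>n. x n \<in> ?E n) \<and> finite {n. x n \<noteq> 0} \<and> v = Sum_any x"
    have ex: "\<exists>x. ?P v x"
    proof (rule span_induct_alt[OF span[of v], of "\<lambda>v. \<exists>x. ?P v x"])
      show "\<exists>x. ?P 0 x" by (rule exI[of _ "\<lambda>_. 0"]) (simp add: A.zero)
    next
      fix c v w assume "v \<in> \<Union> (range ?E)" and "\<exists>x. ?P w x"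
      then obtain m x where m: "A v = \<mu> m *s v" and x: "?P w x" by auto
      let ?e = "\<lambda>n. if n = m then c *s v else 0"
      have "?e n + x n \<in> ?E n" for n
        using m x by (auto simp: A.add A.scale A.zero scale_right_distrib scale_left_commute)
      moreover have fe: "finite {n. ?e n \<noteq> 0}" by (rule finite_subset[of _ "{m}"]) auto
      then have "finite {n. ?e n + x n \<noteq> 0}"
        using x by (intro finite_subset[of "{n. ?e n + x n \<noteq> 0}" "{n. ?e n \<noteq> 0} \<union> {n. x n \<noteq> 0}"]) auto
      moreover have "c *s v + w = (\<Sum>n. ?e n + x n)"
        using Sum_any.distrib[OF fe, of x] x Sum_any.expand_superset[of "{m}" ?e] by auto
      ultimately show "\<exists>x. ?P (c *s v + w) x" by (intro exI[of _ "\<lambda>n. ?e n + x n"]) simp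
    qed
    have "x = y" if x: "?P v x" and y: "?P v y" for x y
    proof
      fix m
      let ?M = "insert m ({n. x n \<noteq> 0} \<union> {n. y n \<noteq> 0})"
      have fin: "finite ?M" using x y by simp
      have "Sum_any x = sum x ?M" "Sum_any y = sum y ?M"
        by (rule Sum_any.expand_superset[OF fin], auto)+
      then have "(\<Sum>n\<in>?M. x n - y n) \<in> {0}" using x y by (simp add: sum_subtractf)
      moreover have "A (x n - y n) = \<mu> n *s (x n - y n)" for n
        using x y by (simp add: A.diff scale_right_diff_distrib)
      ultimately have "x m - y m \<in> {0}"
        by (intro sum_eigenvectors_mem_invariant[of A ?M "\<lambda>n. x n - y n" \<mu> "{0}"] A fin)
          (use inj in \<open>auto simp: A.zero inj_on_def subspace_def\<close>)
      then show "x m = y m" by simp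
    qed
    then show "\<exists>!x. ?P v x" using ex by blast
  qed
qed

end


section \<open>Identities in vertex algebras\<close>

context vertex_algebra
begin

lemma prd_right:
  "prd a n (x + y) = prd a n x + prd a n y" "prd a n (x - y) = prd a n x - prd a n y"
  "prd a n (c *s x) = c *s prd a n x" "prd a n 0 = 0" "prd a n (- x) = - prd a n x"
  "prd a n (sum f A) = (\<Sum>i\<in>A. prd a n (f i))"
proof -
  interpret l: Vector_Spaces.linear scale scale "\<lambda>b. prd a n b" by (rule linear_right)
  show "prd a n (x + y) = prd a n x + prd a n y" "prd a n (x - y) = prd a n x - prd a n y"
    "prd a n (c *s x) = c *s prd a n x" "prd a n 0 = 0" "prd a n (- x) = - prd a n x"
    "prd a n (sum f A) = (\<Sum>i\<in>A. prd a n (f i))"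
    by (rule l.add l.diff l.scale l.zero l.neg l.sum)+
qed

lemma prd_left:
  "prd (x + y) n b = prd x n b + prd y n b" "prd (x - y) n b = prd x n b - prd y n b"
  "prd (c *s x) n b = c *s prd x n b" "prd 0 n b = 0" "prd (- x) n b = - prd x n b"
  "prd (sum f A) n b = (\<Sum>i\<in>A. prd (f i) n b)"
proof -
  interpret l: Vector_Spaces.linear scale scale "\<lambda>a. prd a n b" by (rule linear_left)
  show "prd (x + y) n b = prd x n b + prd y n b" "prd (x - y) n b = prd x n b - prd y n b"
    "prd (c *s x) n b = c *s prd x n b" "prd 0 n b = 0" "prd (- x) n b = - prd x n b"
    "prd (sum f A) n b = (\<Sum>i\<in>A. prd (f i) n b)"
    by (rule l.add l.diff l.scale l.zero l.neg l.sum)+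
qed

lemmas prd_linear = prd_right prd_left

lemma T_linear:
  "T (x + y) = T x + T y" "T (x - y) = T x - T y" "T (c *s x) = c *s T x" "T 0 = 0"
  "T (- x) = - T x" "T (sum f A) = (\<Sum>i\<in>A. T (f i))"
  by (simp_all add: T_def prd_left)

lemma linear_T: "Vector_Spaces.linear scale scale T"
  unfolding linear_iff' by (simp add: T_linear)

lemma T_vac [simp]: "T vac = 0"
  by (simp add: T_def vacuum_left)

lemma prd_span_vac:
  assumes "c \<in> span {vac}" and "n \<noteq> -1"
  shows "prd c n b = 0" "T c = 0"
  using assms by (auto simp: span_singleton prd_left vacuum_left T_linear)

text \<open>The Borcherds identity for \<open>r = 0\<close> and \<open>p \<ge> 0\<close>.\<close>

lemma commutator_formula:
  fixes p :: nat
  shows "prd a (int p) (prd b q c) - prd b q (prd a (int p) c)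
    = (\<Sum>i\<le>p. of_nat (p choose i) *s prd (prd a (int i) b) (int p + q - int i) c)"
proof -
  have "(\<Sum>i::nat. (of_int (int p) gchoose i) *s prd (prd a (0 + int i) b) (int p + q - int i) c)
      = (\<Sum>i\<le>p. (of_int (int p) gchoose i) *s prd (prd a (0 + int i) b) (int p + q - int i) c)"
  proof (rule Sum_any.expand_superset)
    have "(of_int (int p) gchoose i) = (0::'k)" if "p < i" for i
      using that binomial_gbinomial[of p i, where 'a = 'k] by (simp add: binomial_eq_0)
    then show "{i. (of_int (int p) gchoose i) *s prd (prd a (0 + int i) b) (int p + q - int i) c \<noteq> 0}
        \<subseteq> {..p}" by (auto simp: not_less[symmetric])
  qed simp
  moreover have "(\<Sum>i::nat. ((-1) ^ i * (of_int 0 gchoose i)) *s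
        (prd a (int p + 0 - int i) (prd b (q + int i) c)
          - ((-1) powi 0) *s prd b (q + 0 - int i) (prd a (int p + int i) c)))
      = (\<Sum>i::nat\<in>{0}. ((-1) ^ i * (of_int 0 gchoose i)) *s
        (prd a (int p + 0 - int i) (prd b (q + int i) c)
          - ((-1) powi 0) *s prd b (q + 0 - int i) (prd a (int p + int i) c)))"
  proof (rule Sum_any.expand_superset)
    have "(0 gchoose i) = (0::'k)" if "i \<noteq> 0" for i using that by (cases i) simp_all
    then show "{i. ((-1) ^ i * (of_int 0 gchoose i)) *s
        (prd a (int p + 0 - int i) (prd b (q + int i) c)
          - ((-1) powi 0) *s prd b (q + 0 - int i) (prd a (int p + int i) c)) \<noteq> 0} \<subseteq> {0}"
      by auto
  qed simp
  ultimately show ?thesis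
    using Borcherds_identity[of "int p" a 0 b q c] by (simp add: binomial_gbinomial)
qed

lemma commutator_0: "prd a 0 (prd b q c) = prd b q (prd a 0 c) + prd (prd a 0 b) q c"
  using commutator_formula[of a 0 b q c] by (simp add: algebra_simps)

lemma commutator_1:
  "prd a 1 (prd b q c) = prd b q (prd a 1 c) + prd (prd a 0 b) (q + 1) c + prd (prd a 1 b) q c"
  using commutator_formula[of a 1 b q c] by (simp add: algebra_simps)

lemma commutator_2:
  "prd a 2 (prd b q c) = prd b q (prd a 2 c) + prd (prd a 0 b) (q + 2) c
     + 2 *s prd (prd a 1 b) (q + 1) c + prd (prd a 2 b) q c"
  using commutator_formula[of a 2 b q c] by (simp add: algebra_simps numeral_2_eq_2)

text \<open>The Borcherds identity for \<open>b\<close> the vacuum, \<open>r = -2\<close> and \<open>p = 0\<close>.\<close>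

lemma prd_T: "prd (T a) n c = of_int (- n) *s prd a (n - 1) c"
proof -
  have LHS: "(\<Sum>i::nat. (of_int 0 gchoose i) *s prd (prd a (-2 + int i) vac) (0 + n - int i) c)
      = (\<Sum>i::nat\<in>{0}. (of_int 0 gchoose i) *s prd (prd a (-2 + int i) vac) (0 + n - int i) c)"
  proof (rule Sum_any.expand_superset)
    have "(0 gchoose i) = (0::'k)" if "i \<noteq> 0" for i using that by (cases i) simp_all
    then show "{i. (of_int 0 gchoose i) *s prd (prd a (-2 + int i) vac) (0 + n - int i) c \<noteq> 0}
        \<subseteq> {0}" by auto
  qed simp
  have "(-2 gchoose i) = (-1) ^ i * ((1 + of_nat i) :: 'k)" for i
  proof -
    have "(of_nat (Suc i) gchoose i) = (of_nat (Suc i choose i) :: 'k)"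
      by (simp only: binomial_gbinomial)
    then show ?thesis using gbinomial_minus[of "2::'k" i] by (simp add: add.commute)
  qed
  then have coeff: "(-1) ^ i * (of_int (-2) gchoose i) = ((1 + of_nat i) :: 'k)" for i
    by (simp flip: power_mult_distrib)
  define g where "g i = ((-1) ^ i * (of_int (-2) gchoose i)) *s
      (prd a (0 + -2 - int i) (prd vac (n + int i) c)
        - ((-1) powi (-2)) *s prd vac (n + -2 - int i) (prd a (0 + int i) c))" for i :: nat
  have g: "g i = (1 + of_nat i) *s ((if n + int i = -1 then prd a (n - 1) c else 0)
      - (if n - 1 = int i then prd a (n - 1) c else 0))" for i
  proof (cases "n + int i = -1")
    case True
    then have "prd a (-2 - int i) c = prd a (n - 1) c" by (intro arg_cong[of _ _ "\<lambda>k. prd a k c"]) simp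
    then show ?thesis using True unfolding g_def coeff by (simp add: vacuum_left)
  qed (unfold g_def coeff, auto simp: vacuum_left prd_right)
  let ?A = "{nat (- 1 - n), nat (n - 1)}"
  have "Sum_any g = sum g ?A"
    by (rule Sum_any.expand_superset) (auto simp: g split: if_splits)
  also have "\<dots> = of_int (- n) *s prd a (n - 1) c"
  proof -
    consider "n \<le> -1" | "n = 0" | "n = 1" | "n \<ge> 2" by linarith
    then show ?thesis
    proof cases
      case 1
      then have "g (nat (n - 1)) = 0" if "nat (n - 1) \<noteq> nat (-1 - n)" using that by (simp add: g)
      moreover have "g (nat (-1 - n)) = of_int (- n) *s prd a (n - 1) c"
        using 1 by (simp add: g of_nat_nat)
      ultimately show ?thesis by (cases "nat (n - 1) = nat (-1 - n)") simp_all
    next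
      case 4
      then have "g (nat (-1 - n)) = 0" by (simp add: g)
      moreover have "g (nat (n - 1)) = of_int (- n) *s prd a (n - 1) c"
        using 4 by (simp add: g of_nat_nat)
      ultimately show ?thesis using 4 by simp
    qed (simp_all add: g)
  qed
  finally have "Sum_any g = of_int (- n) *s prd a (n - 1) c" .
  then show ?thesis
    using Borcherds_identity[of 0 a "-2" vac n c] LHS by (simp add: T_def g_def)
qed

text \<open>
  The Borcherds identity for \<open>c\<close> the vacuum, \<open>p = -1\<close> and \<open>q = 0\<close>. The vectors \<open>v(-1-i)\<one>\<close> stand
  for \<open>T\<^sup>i v / i!\<close>, and any bound \<open>N\<close> beyond which the products vanish makes the sum finite.
\<close>

lemma skew_symmetry:
  assumes N: "\<And>i. i \<ge> N \<Longrightarrow> prd a (r + int i) b = 0"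
  shows "prd b r a
    = (\<Sum>i<N. ((-1) ^ i * (-1) powi (r + 1)) *s prd (prd a (r + int i) b) (- 1 - int i) vac)"
proof -
  have coeff: "(-1 gchoose i) = ((-1) ^ i :: 'k)" for i
  proof -
    have "(of_nat i gchoose i) = (of_nat (i choose i) :: 'k)" by (simp only: binomial_gbinomial)
    then show ?thesis using gbinomial_minus[of "1::'k" i] by simp
  qed
  have LHS: "(\<Sum>i::nat. (of_int (-1) gchoose i) *s prd (prd a (r + int i) b) (-1 + 0 - int i) vac)
    = (\<Sum>i<N. (of_int (-1) gchoose i) *s prd (prd a (r + int i) b) (-1 + 0 - int i) vac)"
  proof (rule Sum_any.expand_superset)
    have "prd a (r + int i) b = 0" if "i \<notin> {..<N}" for i using that by (intro N) simp
    then show "{i. (of_int (-1) gchoose i) *s prd (prd a (r + int i) b) (-1 + 0 - int i) vac \<noteq> 0}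
        \<subseteq> {..<N}" using prd_left(4) by force
  qed simp
  let ?g = "\<lambda>i::nat. ((-1) ^ i * (of_int r gchoose i)) *s
      (prd a (-1 + r - int i) (prd b (0 + int i) vac)
        - ((-1) powi r) *s prd b (0 + r - int i) (prd a (-1 + int i) vac))"
  have "Sum_any ?g = sum ?g {0}"
  proof (rule Sum_any.expand_superset)
    have "?g i = 0" if "i \<noteq> 0" for i
    proof -
      have "prd a (-1 + int i) vac = 0" using that by (intro vacuum_right) simp
      then show ?thesis by (simp only: vacuum_right prd_right of_nat_0_le_iff add_0) simp
    qed
    then show "{i. ?g i \<noteq> 0} \<subseteq> {0}" by blast
  qed simp
  then have "(\<Sum>i<N. ((-1) ^ i) *s prd (prd a (r + int i) b) (- 1 - int i) vac)
      = - ((-1) powi r *s prd b r a)"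
    using Borcherds_identity[of "-1" a r b 0 vac] LHS
    by (simp add: coeff creation vacuum_right prd_right)
  then have "((-1) powi (r + 1)) *s (\<Sum>i<N. ((-1) ^ i) *s prd (prd a (r + int i) b) (- 1 - int i) vac)
      = ((-1) powi (r + 1)) *s (- ((-1) powi r *s prd b r a))" by simp
  also have "\<dots> = prd b r a"
    by (simp add: power_int_add flip: power_int_mult_distrib)
  finally show ?thesis by (simp add: scale_sum_right mult.commute)
qed

text \<open>The span of all \<open>v(n)u\<close> is the submodule of the adjoint module generated by \<open>u\<close>.\<close>

lemma prd_prd_mem_span:
  "prd x n (prd y m u) \<in> span {prd v k u | v k. True}" (is "_ \<in> ?S")
proof -
  have mem: "prd v k u \<in> ?S" for v k by (rule span_base) blast
  obtain P where P: "\<And>k. k \<ge> P \<Longrightarrow> prd x k u = 0" using truncation by blast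
  obtain N where N: "\<And>k. k \<ge> N \<Longrightarrow> prd y k u = 0" using truncation by blast
  \<comment> \<open>Downward induction on \<open>m\<close>: for \<open>p = P\<close> one half of the Borcherds identity vanishes.\<close>
  show ?thesis
  proof (induction "nat (N - m)" arbitrary: n m rule: less_induct)
    case less
    show ?case
    proof (cases "N \<le> m")
      case True
      then show ?thesis by (simp add: N prd_right span_zero)
    next
      case False
      define K where "K = nat (N - m)"
      let ?g = "\<lambda>i::nat. ((-1) ^ i * (of_int (n - P) gchoose i)) *s
        (prd x (P + (n - P) - int i) (prd y (m + int i) u)
          - ((-1) powi (n - P)) *s prd y (m + (n - P) - int i) (prd x (P + int i) u))"
      let ?h = "\<lambda>i::nat. ((-1) ^ i * (of_int (n - P) gchoose i)) *s
        prd x (n - int i) (prd y (m + int i) u)"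
      have "Sum_any ?g = sum ?h {..<K}"
      proof -
        have "prd y (m + int i) u = 0" if "\<not> i < K" for i
          using that by (intro N) (simp add: K_def)
        then have "Sum_any ?g = sum ?g {..<K}"
          by (intro Sum_any.expand_superset) (force simp: P prd_right)+
        then show ?thesis by (simp add: P prd_right)
      qed
      also have "\<dots> = prd x n (prd y m u) + sum ?h {1..<K}"
        using False by (simp add: K_def sum.atLeast_Suc_lessThan lessThan_atLeast0)
      finally have "prd x n (prd y m u) = Sum_any ?g - sum ?h {1..<K}" by simp
      moreover have "Sum_any ?g \<in> ?S"
        unfolding Borcherds_identity[of P x "n - P" y m u, symmetric] Sum_any.expand_set
        by (intro subspace_sum subspace_span subspace_scale mem)
      moreover have "prd x (n - int i) (prd y (m + int i) u) \<in> ?S" if "i \<in> {1..<K}" for i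
        using that by (intro less) (auto simp: K_def)
      then have "sum ?h {1..<K} \<in> ?S"
        by (intro subspace_sum subspace_span subspace_scale)
      ultimately show ?thesis by (simp add: span_diff)
    qed
  qed
qed

lemma weight_spaceD: "v \<in> weight_space b m \<Longrightarrow> prd b 1 v = of_int m *s v"
  by (simp add: weight_space_def)

lemma prd_weight_space:
  assumes y: "\<And>v. prd y 0 v = T v" and b: "b \<in> weight_space y i" and c: "c \<in> weight_space y j"
  shows "prd b n c \<in> weight_space y (i + j - n - 1)"
proof -
  have "prd y 1 (prd b n c)
      = of_int j *s prd b n c + of_int (- (n + 1)) *s prd b n c + of_int i *s prd b n c"
    using b c by (simp add: commutator_1 y prd_T weight_space_def prd_linear)
  also have "\<dots> = of_int (i + j - n - 1) *s prd b n c"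
  proof -
    have "of_int (i + j - n - 1) = (of_int j + of_int (- (n + 1)) + of_int i :: 'k)" by simp
    then show ?thesis by (simp only: scale_left_distrib)
  qed
  finally show ?thesis by (simp add: weight_space_def)
qed

lemma AutI:
  assumes "\<And>x y. f (x + y) = f x + f y" "\<And>c x. f (c *s x) = c *s f x" "bij f"
    "\<And>a n b. f (prd a n b) = prd (f a) n (f b)" "f vac = vac"
  shows "f \<in> carrier Aut"
  using assms by (simp add: Aut_def linear_iff')

lemma Aut_comp: "f \<in> carrier Aut \<Longrightarrow> g \<in> carrier Aut \<Longrightarrow> f \<circ> g \<in> carrier Aut"
  using group.is_monoid[OF group_Aut, THEN monoid.m_closed, of f g] by (simp add: Aut_def)

lemma Aut_T: "f \<in> carrier Aut \<Longrightarrow> f (T v) = T (f v)"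
  by (simp add: T_def AutD)

end


section \<open>Exponentials of locally nilpotent derivations\<close>

context vertex_algebra
begin

text \<open>
  The exponential of an operator \<open>D\<close>; the sum has finite support on vectors killed by a power of \<open>D\<close>,
  which are the only ones considered.
\<close>

definition exp_map :: "('v \<Rightarrow> 'v) \<Rightarrow> 'v \<Rightarrow> 'v" where
  "exp_map D v = (\<Sum>k. (1 / fact k) *s (D ^^ k) v)"

context
  fixes D :: "'v \<Rightarrow> 'v"
  assumes linear_D: "Vector_Spaces.linear scale scale D"
begin

interpretation D: Vector_Spaces.linear scale scale D by (rule linear_D)

lemma funpow_linear:
  "(D ^^ k) (x + y) = (D ^^ k) x + (D ^^ k) y" "(D ^^ k) (c *s x) = c *s (D ^^ k) x"
  "(D ^^ k) 0 = 0"
  by (induction k) (simp_all add: D.add D.scale D.zero)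

lemma funpow_sum: "(D ^^ k) (sum f A) = (\<Sum>i\<in>A. (D ^^ k) (f i))"
  by (induction k) (simp_all add: D.sum)

lemma funpow_vanish: "(D ^^ N) v = 0 \<Longrightarrow> N \<le> k \<Longrightarrow> (D ^^ k) v = 0"
  using funpow_add[of "k - N" N D] by (simp add: funpow_linear)

lemma exp_map_eq:
  assumes "(D ^^ N) v = 0"
  shows "exp_map D v = (\<Sum>k<N. (1 / fact k) *s (D ^^ k) v)"
  unfolding exp_map_def
proof (rule Sum_any.expand_superset)
  have "(D ^^ k) v = 0" if "k \<notin> {..<N}" for k
    using funpow_vanish[OF assms, of k] that by simp
  then show "{k. (1 / fact k) *s (D ^^ k) v \<noteq> 0} \<subseteq> {..<N}" by force
qed simp

lemma exp_map_unipotent: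
  assumes "(D ^^ Suc N) v = 0"
  shows "(D ^^ N) (exp_map D v - v) = 0"
proof -
  have "exp_map D v - v = (\<Sum>k<N. (1 / fact (Suc k)) *s (D ^^ Suc k) v)"
    using exp_map_eq[OF assms] by (simp add: sum.lessThan_Suc_shift del: sum.lessThan_Suc)
  moreover have "(D ^^ N) ((D ^^ Suc k) v) = 0" for k
    using funpow_vanish[OF assms, of "N + Suc k"] by (simp only: funpow_add comp_apply)
  ultimately show ?thesis by (simp only: funpow_sum funpow_linear) simp
qed

text \<open>Bijectivity comes from unipotency, by induction on the power of \<open>D\<close> that kills the vector.\<close>

lemma exp_map_Aut:
  assumes Leibniz: "\<And>a n b. D (prd a n b) = prd (D a) n b + prd a n (D b)"
    and nilpotent: "\<And>v. \<exists>N. (D ^^ N) v = 0"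
  shows "exp_map D \<in> carrier Aut"
proof -
  have common: "\<exists>N. (D ^^ N) v = 0 \<and> (D ^^ N) w = 0" for v w
    using nilpotent[of v] nilpotent[of w] funpow_vanish by (meson linear)
  have add: "exp_map D (x + y) = exp_map D x + exp_map D y" for x y
  proof -
    obtain N where "(D ^^ N) x = 0" "(D ^^ N) y = 0" using common by blast
    then show ?thesis
      by (simp add: exp_map_eq[of N] funpow_linear scale_right_distrib sum.distrib)
  qed
  have diff: "exp_map D (x - y) = exp_map D x - exp_map D y" for x y
    using add[of "x - y" y] by simp
  have scale: "exp_map D (c *s x) = c *s exp_map D x" for c x
  proof -
    obtain N where "(D ^^ N) x = 0" using nilpotent by blast
    then show ?thesis
      by (simp add: exp_map_eq[of N] funpow_linear scale_sum_right mult.commute)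
  qed
  have inj: "x = 0" if "(D ^^ N) x = 0" "exp_map D x = 0" for N x
    using that
  proof (induction N)
    case (Suc N)
    then show ?case using exp_map_unipotent[of N x] funpow_linear(2)[of N "-1" x] by simp
  qed simp
  have surj: "\<exists>y. exp_map D y = x" if "(D ^^ N) x = 0" for N x
    using that
  proof (induction N arbitrary: x)
    case 0
    then show ?case using scale[of 0 0] by auto
  next
    case (Suc N)
    from Suc.IH[OF exp_map_unipotent[OF Suc.prems]]
    obtain y where "exp_map D y = exp_map D x - x" by blast
    then have "exp_map D (x - y) = x" by (simp add: diff)
    then show ?case by blast
  qed
  have powers: "(D ^^ k) (prd a n b)
      = (\<Sum>i\<le>k. of_nat (k choose i) *s prd ((D ^^ i) a) n ((D ^^ (k - i)) b))" for k a n b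
  proof (induction k)
    case (Suc k)
    let ?t = "\<lambda>i. prd ((D ^^ i) a) n ((D ^^ (Suc k - i)) b)"
    have "(D ^^ Suc k) (prd a n b)
        = (\<Sum>i\<le>k. of_nat (k choose i) *s ?t (Suc i)) + (\<Sum>i\<le>k. of_nat (k choose i) *s ?t i)"
      by (simp add: Suc.IH D.sum D.scale Leibniz scale_right_distrib sum.distrib Suc_diff_le
          del: of_nat_Suc)
    also have "(\<Sum>i\<le>k. of_nat (k choose i) *s ?t i)
        = ?t 0 + (\<Sum>i\<le>k. of_nat (k choose Suc i) *s ?t (Suc i))"
    proof -
      have "(\<Sum>i\<le>k. of_nat (k choose i) *s ?t i) = (\<Sum>i\<le>Suc k. of_nat (k choose i) *s ?t i)"
        by (simp add: binomial_eq_0)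
      also have "\<dots> = ?t 0 + (\<Sum>i\<le>k. of_nat (k choose Suc i) *s ?t (Suc i))"
        by (simp only: sum.atMost_Suc_shift) simp
      finally show ?thesis .
    qed
    also have "(\<Sum>i\<le>k. of_nat (k choose i) *s ?t (Suc i))
        + (?t 0 + (\<Sum>i\<le>k. of_nat (k choose Suc i) *s ?t (Suc i)))
        = ?t 0 + (\<Sum>i\<le>k. of_nat (Suc k choose Suc i) *s ?t (Suc i))"
      by (simp add: scale_left_distrib sum.distrib algebra_simps)
    also have "\<dots> = (\<Sum>i\<le>Suc k. of_nat (Suc k choose i) *s ?t i)"
      by (simp only: sum.atMost_Suc_shift) simp
    finally show ?case .
  qed simp
  have mult: "exp_map D (prd a n b) = prd (exp_map D a) n (exp_map D b)" for a n b
  proof -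
    obtain N where N: "(D ^^ N) a = 0" "(D ^^ N) b = 0" using common by blast
    let ?f = "\<lambda>i j. (1 / (fact i * fact j)) *s prd ((D ^^ i) a) n ((D ^^ j) b)"
    have vanish: "?f i j = 0" if "N \<le> i \<or> N \<le> j" for i j
      using that funpow_vanish N by (auto simp: prd_linear)
    have "(D ^^ (2 * N)) (prd a n b) = 0"
      unfolding powers
    proof (rule sum.neutral, rule ballI)
      fix i
      have "N \<le> i \<or> N \<le> 2 * N - i" by linarith
      then show "of_nat (2 * N choose i) *s prd ((D ^^ i) a) n ((D ^^ (2 * N - i)) b) = 0"
        using funpow_vanish N by (auto simp: prd_linear)
    qed
    then have "exp_map D (prd a n b) = (\<Sum>k<2 * N. (1 / fact k) *s (D ^^ k) (prd a n b))"
      by (rule exp_map_eq)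
    also have "\<dots> = (\<Sum>k<2 * N. \<Sum>i\<le>k. ?f i (k - i))"
      by (intro sum.cong refl) (simp add: powers scale_sum_right binomial_fact)
    also have "\<dots> = (\<Sum>(i, j)\<in>{(i, j). i + j < 2 * N}. ?f i j)"
      by (rule sum.triangle_reindex[symmetric])
    also have "\<dots> = (\<Sum>(i, j)\<in>{..<N} \<times> {..<N}. ?f i j)"
    proof (rule sum.mono_neutral_right)
      show "finite {(i, j). i + j < 2 * N}"
        by (rule finite_subset[of _ "{..<2 * N} \<times> {..<2 * N}"]) auto
      show "\<forall>p\<in>{(i, j). i + j < 2 * N} - {..<N} \<times> {..<N}. (case p of (i, j) \<Rightarrow> ?f i j) = 0"
      proof
        fix p assume "p \<in> {(i, j). i + j < 2 * N} - {..<N} \<times> {..<N}"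
        then obtain i j where "p = (i, j)" "N \<le> i \<or> N \<le> j" by (cases p) auto
        then show "(case p of (i, j) \<Rightarrow> ?f i j) = 0" using vanish by simp
      qed
    qed auto
    also have "\<dots> = prd (exp_map D a) n (exp_map D b)"
      unfolding exp_map_eq[OF N(1)] exp_map_eq[OF N(2)] prd_left(6)
      by (simp add: prd_linear scale_sum_right mult.commute flip: sum.cartesian_product)
    finally show ?thesis .
  qed
  have "D vac = 0" using Leibniz[of vac "-1" vac] by (simp add: vacuum_left creation)
  then have vac: "exp_map D vac = vac" using exp_map_eq[of 1 vac] by simp
  have "inj (exp_map D)"
  proof (rule injI)
    fix x y assume "exp_map D x = exp_map D y"
    then have "exp_map D (x - y) = 0" by (simp add: diff)
    then show "x = y" using inj nilpotent by (metis eq_iff_diff_eq_0)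
  qed
  moreover have "x \<in> range (exp_map D)" for x
  proof -
    obtain N where "(D ^^ N) x = 0" using nilpotent by blast
    then obtain y where "exp_map D y = x" using surj by blast
    then show ?thesis by (rule range_eqI[OF sym])
  qed
  ultimately show ?thesis by (intro AutI add scale mult vac) (auto simp: bij_def)
qed

end

end


section \<open>Zero modes in vertex algebras of CFT type\<close>

context graded_vertex_algebra
begin

lemma prd_filtration:
  assumes b: "b \<in> filtration G i" and c: "c \<in> filtration G j"
  shows "prd b n c \<in> filtration G (i + j - n - 1)"
proof -
  have "prd b n c = prd (\<Sum>k | component G b k \<noteq> 0. component G b k) n
      (\<Sum>l | component G c l \<noteq> 0. component G c l)"
    by (simp flip: sum_component[OF direct_sum])
  also have "\<dots> = (\<Sum>k | component G b k \<noteq> 0. \<Sum>l | component G c l \<noteq> 0.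
      prd (component G b k) n (component G c l))"
    by (rule trans[OF prd_left(6) sum.cong[OF refl prd_right(6)]])
  also have "\<dots> \<in> filtration G (i + j - n - 1)"
  proof (intro subspace_sum subspace_filtration direct_sum)
    fix k l assume "k \<in> {k. component G b k \<noteq> 0}" "l \<in> {l. component G c l \<noteq> 0}"
    then have "i \<le> k" "j \<le> l" using b c by (auto simp: filtration_def not_less[symmetric])
    then show "prd (component G b k) n (component G c l) \<in> filtration G (i + j - n - 1)"
      by (intro filtration_homogeneous[OF direct_sum prd_degree[OF component_mem component_mem]])
        (use direct_sum in auto)
  qed
  finally show ?thesis .
qed

lemma component_prd:
  assumes b: "b \<in> filtration G i" and c: "c \<in> filtration G j"
  shows "component G (prd b n c) (i + j - n - 1) = prd (component G b i) n (component G c j)"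
proof -
  let ?b = "component G b i" and ?c = "component G c j" and ?d = "i + j - n - 1"
  have b': "b - ?b \<in> filtration G (i + 1)" and c': "c - ?c \<in> filtration G (j + 1)"
    using filtration_split[OF direct_sum] b c by blast+
  have "?b \<in> filtration G i"
    by (rule filtration_homogeneous[OF direct_sum component_mem[OF direct_sum] order.refl])
  then have "component G (prd ?b n (c - ?c)) ?d = 0" "component G (prd (b - ?b) n c) ?d = 0"
    using prd_filtration[OF _ c', of ?b i n] prd_filtration[OF b' c, of n]
    by (simp_all add: filtration_def)
  moreover have "component G (prd ?b n ?c) ?d = prd ?b n ?c"
    using component_homogeneous[OF direct_sum prd_degree[OF component_mem component_mem]] direct_sum
    by simp
  moreover have "prd b n c = prd ?b n ?c + prd ?b n (c - ?c) + prd (b - ?b) n c"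
    by (simp add: prd_linear)
  ultimately show ?thesis by (simp add: component_add[OF direct_sum])
qed

lemma T_degree: "v \<in> G n \<Longrightarrow> T v \<in> G (n + 1)"
  using prd_degree[OF _ vac_degree, of v n "-2"] by (simp add: T_def add.commute)

lemma component_T: "component G (T v) n = T (component G v (n - 1))"
  by (rule component_degree_shift[OF direct_sum linear_T T_degree])

lemma zero_mode_component:
  assumes x: "\<And>b. prd x 0 b = 0"
  shows "prd (component G x n) 0 b = 0"
proof -
  have "prd (component G x n) 0 b = 0" if "b \<in> G m" for b m
    using component_degree_shift[OF direct_sum linear_left[of 0 b], of "m - 1" x "n + (m - 1)"]
      prd_degree[OF _ that, of _ _ 0] x
    by (simp add: component_zero[OF direct_sum] algebra_simps)
  then have "prd (component G x n) 0 (component G b m) = 0" for m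
    using component_mem[OF direct_sum] by blast
  then show ?thesis
    by (subst sum_component[OF direct_sum, of b]) (simp add: prd_right)
qed

end

context conformal_vertex_algebra
begin

lemma T_derivation: "T (prd a n b) = prd (T a) n b + prd a n (T b)"
  using commutator_0[of \<omega> a n b] by (simp add: L_minus_1)

lemma T_prd_vac: "T (prd v (- n) vac) = of_int n *s prd v (- 1 - n) vac"
proof -
  have "- n - 1 = - 1 - n" by simp
  then show ?thesis by (simp only: T_derivation prd_T prd_right T_vac) simp
qed

lemma prd_vac_in_range_T:
  assumes w: "w \<in> G d" and k: "k \<ge> 1"
  shows "\<exists>z\<in>G (d + int k - 1). prd w (- 1 - int k) vac = T z"
proof (rule bexI)
  show "prd w (- 1 - int k) vac = T ((1 / of_nat k) *s prd w (- int k) vac)"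
    using k T_prd_vac[of w "int k"] by (simp add: T_linear algebra_simps)
  show "(1 / of_nat k) *s prd w (- int k) vac \<in> G (d + int k - 1)"
    using prd_degree[OF w vac_degree, of "- int k"]
    by (simp add: subspace_scale subspace_summand[OF direct_sum])
qed

end

context CFT_type_voa
begin

lemma degree_neg: "v \<in> G n \<Longrightarrow> n < 0 \<Longrightarrow> v = 0"
  using degree_nonneg by auto

lemma T_degree_0: "v \<in> G 0 \<Longrightarrow> T v = 0"
  using prd_span_vac(2)[of v 0] by (simp add: degree_0)

text \<open>If \<open>T v = 0\<close>, then \<open>v(m) = 0\<close> for \<open>m \<noteq> -1\<close>, so \<open>L(0)v = 0\<close> by skew symmetry.\<close>

lemma kernel_T:
  assumes "T v = 0"
  shows "v \<in> G 0"
proof -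
  have "prd v m c = 0" if "m \<noteq> -1" for m c
  proof -
    have "of_int (- (m + 1)) *s prd v m c = 0"
      using prd_T[of v "m + 1" c] assms by (simp only: prd_left add_diff_cancel_right')
    moreover have "of_int (- (m + 1)) \<noteq> (0::'k)"
      unfolding of_int_eq_0_iff using that by simp
    ultimately show ?thesis by simp
  qed
  then have "prd \<omega> 1 v = 0"
    using skew_symmetry[of 0 v 1 \<omega>] by simp
  then show ?thesis by (simp add: weight_space_def flip: weight_space_omega)
qed

lemma T_inj_homogeneous: "T v = 0 \<Longrightarrow> v \<in> G n \<Longrightarrow> n \<noteq> 0 \<Longrightarrow> v = 0"
  using kernel_T homogeneous_disjoint[OF direct_sum] by blast

text \<open>
  Apart from weight one and the vacuum, only derivatives have vanishing zero mode; this is read off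
  from \<open>0 = x(0)\<omega>\<close> and skew symmetry.
\<close>

lemma zero_mode_homogeneous:
  assumes x: "x \<in> G n" and n: "n \<ge> 2" and zero: "\<And>b. prd x 0 b = 0"
  shows "\<exists>y\<in>G (n - 1). x = T y"
proof -
  define w where "w i = prd \<omega> (int i) x" for i :: nat
  have w: "w i \<in> G (n + 1 - int i)" for i
    using prd_degree[OF omega_degree x, of "int i"] by (simp add: w_def algebra_simps)
  have "\<exists>z\<in>G (n - 1). prd (w i) (- 1 - int i) vac = T (T z)" if i: "i \<ge> 2" for i
  proof -
    obtain z where z: "z \<in> G (n - 1)" "prd (w i) (- int i) vac = T z"
    proof -
      have "n + 1 - int i + int (i - 1) - 1 = n - 1" "- 1 - int (i - 1) = - int i"
        "1 \<le> i - 1"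
        using i by simp_all
      then show ?thesis using prd_vac_in_range_T[OF w[of i], of "i - 1"] i that by auto
    qed
    have "prd (w i) (- 1 - int i) vac = (1 / of_nat i) *s T (prd (w i) (- int i) vac)"
      using i T_prd_vac[of "w i" "int i"] by (simp add: algebra_simps)
    then have "prd (w i) (- 1 - int i) vac = T (T ((1 / of_nat i) *s z))"
      by (simp add: z(2) T_linear)
    then show ?thesis
      using subspace_scale[OF subspace_summand[OF direct_sum] z(1)] by blast
  qed
  then obtain z where z: "\<And>i. i \<ge> 2 \<Longrightarrow> z i \<in> G (n - 1)"
    "\<And>i. i \<ge> 2 \<Longrightarrow> prd (w i) (- 1 - int i) vac = T (T (z i))" by metis
  define N where "N = nat (n + 2)"
  have N: "N \<ge> 2" using n by (simp add: N_def)
  have "w i = 0" if "i \<ge> N" for i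
    using n w[of i] degree_neg[of "w i"] that by (simp add: N_def)
  then have "prd x 0 \<omega> = (\<Sum>i<N. ((-1) ^ i * (-1) powi 1) *s prd (w i) (- 1 - int i) vac)"
    using skew_symmetry[of N \<omega> 0 x] by (simp add: w_def)
  then have "0 = (\<Sum>i<N. (- ((-1) ^ i)) *s prd (w i) (- 1 - int i) vac)"
    by (simp add: zero)
  also have "{..<N} = {0, 1} \<union> {2..<N}" using N by auto
  also have "(\<Sum>i\<in>{0, 1} \<union> {2..<N}. (- ((-1) ^ i)) *s prd (w i) (- 1 - int i) vac)
      = - T x + of_int n *s T x + (\<Sum>i\<in>{2..<N}. (- ((-1) ^ i)) *s T (T (z i)))"
  proof -
    have "(\<Sum>i\<in>{2..<N}. (- ((-1) ^ i)) *s prd (w i) (- 1 - int i) vac)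
        = (\<Sum>i\<in>{2..<N}. (- ((-1) ^ i)) *s T (T (z i)))"
      by (intro sum.cong refl) (simp add: z)
    moreover have "w 0 = T x" "w 1 = of_int n *s x"
      by (simp_all add: w_def L_minus_1 L0_degree[OF x])
    ultimately show ?thesis
      by (subst sum.union_disjoint) (auto simp: creation T_def[symmetric] T_linear)
  qed
  also have "\<dots> = T (of_int (n - 1) *s x + T (\<Sum>i\<in>{2..<N}. (- ((-1) ^ i)) *s z i))" (is "_ = T (_ + T ?z)")
    by (simp add: T_linear scale_left_diff_distrib)
  \<comment> \<open>The terms \<open>i = 0, 1\<close> contribute \<open>(n - 1) T x\<close>; all others lie in the image of \<open>T \<circ> T\<close>.\<close>
  finally have "T (of_int (n - 1) *s x + T ?z) = 0" by simp
  moreover have zG: "?z \<in> G (n - 1)"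
    by (intro subspace_sum subspace_scale subspace_summand[OF direct_sum]) (simp add: z)
  then have "of_int (n - 1) *s x + T ?z \<in> G n"
    using T_degree[of ?z "n - 1"] x subspace_summand[OF direct_sum, of n]
    by (intro subspace_add subspace_scale) simp_all
  ultimately have "of_int (n - 1) *s x + T ?z = 0" using T_inj_homogeneous n by simp
  then have "of_int (n - 1) *s x = - T ?z" by (simp add: eq_neg_iff_add_eq_0)
  then have "(1 / of_int (n - 1)) *s of_int (n - 1) *s x = (1 / of_int (n - 1)) *s (- T ?z)" by simp
  moreover have "of_int (n - 1) \<noteq> (0::'k)" using n by (simp only: of_int_eq_0_iff)
  ultimately have "x = T ((- 1 / of_int (n - 1)) *s ?z)"
    by (simp add: T_linear)
  then show ?thesis
    using subspace_scale[OF subspace_summand[OF direct_sum] zG] by blast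
qed

lemma zero_mode_filtration:
  assumes x: "x \<in> filtration G k" and k: "k \<ge> 2" and zero: "\<And>b. prd x 0 b = 0"
  shows "\<exists>z\<in>filtration G (k - 1). x = T z"
proof -
  have "\<exists>y\<in>G (n - 1). component G x n = T y" if "n \<ge> 2" for n
    using zero_mode_homogeneous[OF component_mem[OF direct_sum] that]
      zero_mode_component[OF zero] by blast
  then obtain y where y: "\<And>n. n \<ge> 2 \<Longrightarrow> y n \<in> G (n - 1)"
    "\<And>n. n \<ge> 2 \<Longrightarrow> component G x n = T (y n)" by metis
  let ?S = "{n. component G x n \<noteq> 0}"
  have S: "n \<ge> k" if "n \<in> ?S" for n using that x by (auto simp: filtration_def not_less[symmetric])
  have "x = (\<Sum>n\<in>?S. T (y n))"
    using sum_component[OF direct_sum, of x] S k y(2) by (metis (no_types, lifting) order_trans sum.cong)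
  then have "x = T (\<Sum>n\<in>?S. y n)" by (simp add: T_linear)
  moreover have "(\<Sum>n\<in>?S. y n) \<in> filtration G (k - 1)"
  proof (intro subspace_sum subspace_filtration direct_sum)
    fix n assume "n \<in> ?S"
    then show "y n \<in> filtration G (k - 1)"
      using filtration_homogeneous[OF direct_sum y(1), of n "k - 1"] S[of n] k by simp
  qed
  ultimately show ?thesis by blast
qed

lemma weight_one_zero_mode_omega:
  assumes v: "v \<in> G 1"
  shows "prd v 0 \<omega> = 0"
proof -
  have d: "prd \<omega> k v \<in> G (2 - k)" for k using prd_degree[OF omega_degree v, of k] by simp
  have "prd \<omega> (0 + int i) v = 0" if "i \<ge> 3" for i using d[of "int i"] degree_neg that by simp
  from skew_symmetry[of 3, OF this] show ?thesis
    using d[of 2] by (simp add: eval_nat_numeral creation L_minus_1 L0_degree[OF v] T_def[of v, symmetric]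
      prd_span_vac(1) degree_0)
qed

lemma weight_one_prd_omega:
  assumes v: "v \<in> G 1"
  shows "prd v 1 \<omega> = v"
proof -
  have d: "prd \<omega> k v \<in> G (2 - k)" for k using prd_degree[OF omega_degree v, of k] by simp
  have "prd \<omega> (1 + int i) v = 0" if "i \<ge> 2" for i using d[of "1 + int i"] degree_neg that by simp
  from skew_symmetry[of 2, OF this] show ?thesis
    using d[of 2] by (simp add: eval_nat_numeral creation L0_degree[OF v]
      prd_span_vac(1) degree_0)
qed

lemma weight_one_bracket_antisym:
  assumes v: "v \<in> G 1" and w: "w \<in> G 1"
  shows "prd w 0 v = - prd v 0 w"
proof -
  have d: "prd v k w \<in> G (1 - k)" for k using prd_degree[OF v w, of k] by simp
  have "prd v (0 + int i) w = 0" if "i \<ge> 2" for i using d[of "int i"] degree_neg that by simp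
  from skew_symmetry[of 2, OF this] show ?thesis
    using d[of 1] by (simp add: eval_nat_numeral creation prd_span_vac(1) degree_0)
qed

end


section \<open>Leading components of conformal vectors\<close>

context CFT_type_voa
begin

lemma CV_CFT_T: "a \<in> CV_CFT \<Longrightarrow> prd a 0 v = T v"
  using conformal_vertex_algebra.L_minus_1 CFT_type_voa.axioms(1) unfolding CV_CFT_def by blast

lemma component_CV_CFT_difference:
  assumes a: "a \<in> CV_CFT"
  obtains z where "a = \<omega> + component G a 0 + component G a 1 + T z"
    and "\<And>b. prd (component G a 1) 0 b = 0"
proof -
  let ?x = "a - \<omega>"
  have zero: "prd ?x 0 b = 0" for b using CV_CFT_T[OF a] by (simp add: prd_left L_minus_1)
  have c: "component G ?x 0 = component G a 0" "component G ?x 1 = component G a 1"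
    by (simp_all add: component_diff[OF direct_sum] component_homogeneous[OF direct_sum omega_degree])
  have z: "prd (component G a 0) 0 b = 0" "prd (component G a 1) 0 b = 0" for b
    using zero_mode_component[OF zero] c by metis+
  let ?r = "?x - component G a 0 - component G a 1"
  have "component G ?r k = 0" if "k < 2" for k
  proof -
    have "k < 0 \<or> k = 0 \<or> k = 1" using that by linarith
    then show ?thesis
      using degree_neg[OF component_mem[OF direct_sum, of ?r k]] c
      by (auto simp: component_diff[OF direct_sum, of "?x - _"] component_diff[OF direct_sum, of ?x]
          component_idem[OF direct_sum])
  qed
  then have "?r \<in> filtration G 2" by (simp add: filtration_def)
  moreover have "prd ?r 0 b = 0" for b using zero z by (simp add: prd_left)
  ultimately obtain w where "?r = T w" using zero_mode_filtration[of ?r 2] by auto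
  then have "a = \<omega> + component G a 0 + component G a 1 + T w" by (simp add: algebra_simps)
  then show ?thesis using that z(2) by blast
qed

text \<open>
  Since \<open>h(0) = 0\<close>, the operator \<open>h(1)\<close> is a locally nilpotent derivation; it sends \<open>\<omega>\<close> to \<open>h\<close>, so
  the exponential of \<open>- h(1)\<close> removes the component \<open>h\<close> of weight one.
\<close>

lemma ex_Aut_component_1_zero:
  assumes a: "a \<in> CV_CFT"
  shows "\<exists>f\<in>carrier Aut. component G (f a) 1 = 0"
proof -
  define h where "h = component G a 1"
  obtain z where z: "a = \<omega> + component G a 0 + h + T z" and h0: "\<And>b. prd h 0 b = 0"
    using component_CV_CFT_difference[OF a] unfolding h_def by blast
  have h: "h \<in> G 1" unfolding h_def by (rule component_mem[OF direct_sum])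
  define D where "D v = - prd h 1 v" for v
  have lin: "Vector_Spaces.linear scale scale D"
    by (simp add: linear_iff' D_def prd_right)
  have deg: "D v \<in> G (n - 1)" if "v \<in> G n" for v n
    using prd_degree[OF h that, of 1] subspace_neg[OF subspace_summand[OF direct_sum]]
    by (simp add: D_def)
  have degs: "(D ^^ k) v \<in> G (n - int k)" if "v \<in> G n" for k v n
  proof (induction k)
    case (Suc k)
    then show ?case using deg[of "(D ^^ k) v" "n - int k"] by (simp add: algebra_simps)
  qed (use that in simp)
  have hom: "(D ^^ k) v = 0" if "v \<in> G n" "n < int k" for k v n
    using degs[OF that(1), of k] degree_neg that(2) by force
  have nil: "\<exists>N. (D ^^ N) v = 0" for v
  proof -
    define N where "N = Suc (nat (Max (insert 0 {n. component G v n \<noteq> 0})))"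
    have "(D ^^ N) (component G v n) = 0" for n
    proof (cases "component G v n = 0")
      case False
      then have "n \<le> Max (insert 0 {n. component G v n \<noteq> 0})"
        using finite_component[OF direct_sum, of v] by (intro Max_ge) auto
      then have "n < int N" by (simp add: N_def)
      then show ?thesis by (rule hom[OF component_mem[OF direct_sum]])
    qed (simp add: funpow_linear[OF lin])
    then have "(D ^^ N) v = 0"
      by (subst sum_component[OF direct_sum, of v]) (simp add: funpow_sum[OF lin])
    then show ?thesis ..
  qed
  let ?E = "exp_map D"
  have E: "?E \<in> carrier Aut"
    by (rule exp_map_Aut[OF lin _ nil]) (simp add: D_def commutator_1 h0 prd_linear)
  have "component G (?E \<omega>) 1 = - h"
  proof -
    have "(D ^^ 3) \<omega> = 0" by (rule hom[OF omega_degree]) simp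
    then have "?E \<omega> = (\<Sum>k<3. (1 / fact k) *s (D ^^ k) \<omega>)" by (rule exp_map_eq[OF lin])
    then have *: "?E \<omega> = \<omega> + D \<omega> + (1 / 2) *s (D ^^ 2) \<omega>" by (simp add: eval_nat_numeral)
    have "D \<omega> = - h" by (simp add: D_def weight_one_prd_omega[OF h])
    moreover have "(D ^^ 2) \<omega> \<in> G 0" using degs[OF omega_degree, of 2] by simp
    ultimately show ?thesis
      by (simp add: * component_add[OF direct_sum] component_diff[OF direct_sum]
        component_scale[OF direct_sum] component_homogeneous[OF direct_sum omega_degree]
        component_homogeneous[OF direct_sum h]
        component_homogeneous[OF direct_sum, of "(D ^^ 2) \<omega>" 0])
  qed
  moreover have "component G (?E h) 1 = h"
  proof -
    have "(D ^^ 2) h = 0" by (rule hom[OF h]) simp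
    then have "?E h = (\<Sum>k<2. (1 / fact k) *s (D ^^ k) h)" by (rule exp_map_eq[OF lin])
    then have "?E h = h + D h" by (simp add: eval_nat_numeral)
    then show ?thesis
      using deg[OF h] by (simp add: component_add[OF direct_sum] component_homogeneous[OF direct_sum h]
        component_homogeneous[OF direct_sum, of "D h" 0])
  qed
  moreover have "component G (?E (component G a 0)) 1 = 0"
  proof -
    have "component G a 0 \<in> span {vac}" using component_mem[OF direct_sum, of a 0] by (simp add: degree_0)
    then have "?E (component G a 0) \<in> span {vac}"
      by (auto simp: span_singleton AutD[OF E])
    then show ?thesis using component_homogeneous[OF direct_sum, of _ 0] by (simp add: degree_0)
  qed
  moreover have "component G (?E (T z)) 1 = 0"
    by (simp add: Aut_T[OF E] component_T T_degree_0[OF component_mem[OF direct_sum]])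
  ultimately have "component G (?E a) 1 = 0"
    by (subst z) (simp add: AutD(1)[OF E] component_add[OF direct_sum])
  then show ?thesis using E by blast
qed

text \<open>The eigenspaces of \<open>b(1)\<close>, for \<open>b\<close> the component of weight two of \<open>a\<close>.\<close>

abbreviation leading_grading :: "'v \<Rightarrow> int \<Rightarrow> 'v set" where
  "leading_grading a \<equiv> weight_space (component G a 2)"

context
  fixes a :: 'v
  assumes a: "a \<in> CV_CFT" and a1: "component G a 1 = 0"
begin

interpretation A: CFT_type_voa scale prd vac "weight_space a" a
  using a by (simp add: CV_CFT_def)

lemma reduced_filtration: "a - component G a 0 \<in> filtration G 2"
proof -
  have "component G (a - component G a 0) k = 0" if "k < 2" for k
  proof -
    have "k < 0 \<or> k = 0 \<or> k = 1" using that by linarith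
    then show ?thesis
      using degree_neg[OF component_mem[OF direct_sum, of a k]] a1
      by (auto simp: component_diff[OF direct_sum] component_idem[OF direct_sum])
  qed
  then show ?thesis by (simp add: filtration_def)
qed

lemma component_0_span_vac: "component G a 0 \<in> span {vac}"
  using component_mem[OF direct_sum, of a 0] by (simp add: degree_0)

lemma prd_reduced: "n \<noteq> -1 \<Longrightarrow> prd (a - component G a 0) n b = prd a n b"
  using prd_span_vac(1)[OF component_0_span_vac] by (simp add: prd_left)

lemma component_reduced: "component G (a - component G a 0) 2 = component G a 2"
  by (simp add: component_diff[OF direct_sum] component_idem[OF direct_sum])

lemma component_prd_conformal:
  assumes "v \<in> filtration G n" and "k \<noteq> -1"
  shows "prd a k v \<in> filtration G (n - k + 1)"
    and "component G (prd a k v) (n - k + 1) = prd (component G a 2) k (component G v n)"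
proof -
  have deg: "2 + n - k - 1 = n - k + 1" by simp
  show "prd a k v \<in> filtration G (n - k + 1)"
    "component G (prd a k v) (n - k + 1) = prd (component G a 2) k (component G v n)"
    using prd_filtration[OF reduced_filtration assms(1), of k]
      component_prd[OF reduced_filtration assms(1), of k]
    unfolding deg prd_reduced[OF assms(2)] component_reduced by blast+
qed

lemma leading_0: "prd (component G a 2) 0 v = T v"
proof -
  have hom: "prd (component G a 2) 0 v = T v" if "v \<in> G n" for v n
    using component_prd_conformal(2)[OF filtration_homogeneous[OF direct_sum that order.refl], of 0]
    by (simp add: component_homogeneous[OF direct_sum that] A.L_minus_1
        component_homogeneous[OF direct_sum T_degree[OF that]])
  show ?thesis
    by (subst (1 2) sum_component[OF direct_sum, of v])
      (simp add: prd_right T_linear hom[OF component_mem[OF direct_sum]])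
qed

lemma leading_mem_leading_grading: "component G a 2 \<in> leading_grading a 2"
proof -
  have "prd a 1 (a - component G a 0) = 2 *s a"
    using A.L0_degree[OF A.omega_degree] component_0_span_vac
    by (auto simp: prd_right span_singleton vacuum_right)
  then show ?thesis
    using component_prd_conformal(2)[OF reduced_filtration, of 1]
    by (simp add: component_reduced component_scale[OF direct_sum] weight_space_def)
qed

lemma leading_degree: "v \<in> G n \<Longrightarrow> prd (component G a 2) 1 v \<in> G n"
  using prd_degree[OF component_mem[OF direct_sum, of a 2], of v n 1] by simp

lemma leading_filtration: "v \<in> filtration G n \<Longrightarrow> prd (component G a 2) 1 v \<in> filtration G n"
  using prd_filtration[of "component G a 2" 2 v n 1]
    filtration_homogeneous[OF direct_sum component_mem[OF direct_sum] order.refl] by force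

text \<open>
  On leading components for the filtration of \<open>G\<close>, the operator \<open>a(1)\<close> induces \<open>b(1)\<close> with \<open>b\<close> the
  component of weight two of \<open>a\<close>; hence \<open>b(1)\<close> is diagonalizable on each \<open>G n\<close>.
\<close>

lemma leading_eigenvectors:
  assumes x: "x \<in> G n"
  defines "y m \<equiv> component G (component (weight_space a) x m) n"
  shows "y m \<in> leading_grading a m" "x = (\<Sum>m | component (weight_space a) x m \<noteq> 0. y m)"
proof -
  have inj: "inj (of_int :: int \<Rightarrow> 'k)" by (simp add: inj_def)
  have lead: "prd a 1 v \<in> filtration G n"
    "component G (prd a 1 v) n = prd (component G a 2) 1 (component G v n)"
    if "v \<in> filtration G n" for v
    using component_prd_conformal[OF that, of 1] by simp_all
  note L = leading_components_eigenvectors[OF direct_sum A.direct_sum linear_right weight_spaceD inj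
      lead(1) lead(2) x]
  show "y m \<in> leading_grading a m" "x = (\<Sum>m | component (weight_space a) x m \<noteq> 0. y m)"
    using L(2) L(3) by (simp_all add: y_def weight_space_def)
qed

lemma direct_sum_leading_grading: "direct_sum_decomposition (leading_grading a)"
  unfolding weight_space_def
proof (rule direct_sum_eigenspaces[OF linear_right])
  let ?U = "\<Union>m. {v. prd (component G a 2) 1 v = of_int m *s v}"
  have hom: "x \<in> span ?U" if "x \<in> G n" for x n
    by (subst leading_eigenvectors(2)[OF that], intro span_sum span_base)
      (use leading_eigenvectors(1)[OF that] in \<open>auto simp: weight_space_def\<close>)
  show "v \<in> span ?U" for v
    by (subst sum_component[OF direct_sum, of v]) (intro span_sum hom[OF component_mem[OF direct_sum]])
qed (simp add: inj_def)

text \<open>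
  An eigenvector of \<open>b(1)\<close> in \<open>G n\<close> is the leading component of an eigenvector of \<open>a(1)\<close>, and \<open>a\<close> is
  of CFT type.
\<close>

lemma leading_grading_homogeneous:
  assumes x: "x \<in> G n" "x \<in> leading_grading a m" "x \<noteq> 0"
  shows "m \<ge> 0" "m = 0 \<Longrightarrow> n = 0"
proof -
  let ?W = "leading_grading a" and ?E = "weight_space a"
  let ?M = "{m. component ?E x m \<noteq> 0}"
  let ?y = "\<lambda>m. component G (component ?E x m) n"
  have "x = component ?W (\<Sum>l\<in>?M. ?y l) m"
    by (subst leading_eigenvectors(2)[OF x(1), symmetric])
      (simp add: component_homogeneous[OF direct_sum_leading_grading x(2)])
  also have "\<dots> = (\<Sum>l\<in>?M. if m = l then ?y l else 0)"
    by (simp add: component_sum[OF direct_sum_leading_grading]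
      component_homogeneous[OF direct_sum_leading_grading leading_eigenvectors(1)[OF x(1)]])
  also have "\<dots> = (if m \<in> ?M then ?y m else 0)"
    using finite_component[OF A.direct_sum, of x] by simp
  finally have y: "component ?E x m \<noteq> 0" "?y m \<noteq> 0" using x(3) by (auto split: if_splits)
  have mem: "component ?E x m \<in> ?E m" by (rule component_mem[OF A.direct_sum])
  show "m \<ge> 0" using A.degree_neg[OF mem] y by force
  show "n = 0" if "m = 0"
    using mem that y(2) component_homogeneous[OF direct_sum, of "component ?E x m" 0 n]
    by (auto simp: A.degree_0 degree_0 split: if_splits)
qed

lemma component_leading_grading:
  assumes y: "y \<in> leading_grading a m" and "component G y n \<noteq> 0"
  shows "m \<ge> 0" "m = 0 \<Longrightarrow> n = 0"
proof -
  have "component G y n \<in> leading_grading a m"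
    using component_degree_shift[OF direct_sum linear_right[of "component G a 2" 1], of 0 y n]
      leading_degree y
    by (simp add: weight_space_def component_scale[OF direct_sum])
  then show "m \<ge> 0" "m = 0 \<Longrightarrow> n = 0"
    using leading_grading_homogeneous[OF component_mem[OF direct_sum]] assms(2) by blast+
qed

lemma filtration_component_leading_grading:
  assumes "x \<in> filtration G n"
  shows "component (leading_grading a) x m \<in> filtration G n"
proof (rule component_mem_invariant[OF direct_sum_leading_grading
      linear_right[of "component G a 2" 1] weight_spaceD])
  show "inj (of_int :: int \<Rightarrow> 'k)" by (simp add: inj_def)
qed (use assms leading_filtration subspace_filtration[OF direct_sum] in auto)

lemma filtration_1_leading_grading: "filtration G 1 \<subseteq> filtration (leading_grading a) 1"
proof
  fix x assume x: "x \<in> filtration G 1"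
  have "component (leading_grading a) x m = 0" if "m < 1" for m
  proof -
    let ?y = "component (leading_grading a) x m"
    have y: "?y \<in> filtration G 1" by (rule filtration_component_leading_grading[OF x])
    have "component G ?y n = 0" for n
    proof (rule ccontr)
      assume n: "component G ?y n \<noteq> 0"
      then have "n \<ge> 1" using y by (auto simp: filtration_def not_less[symmetric])
      then show False
        using component_leading_grading[OF component_mem[OF direct_sum_leading_grading] n] that
        by auto
    qed
    then show ?thesis
      using eq_if_components_eq[OF direct_sum, of ?y 0] by (simp add: component_zero[OF direct_sum])
  qed
  then show "x \<in> filtration (leading_grading a) 1" by (simp add: filtration_def)
qed

interpretation W: graded_vertex_algebra scale prd vac "leading_grading a"
proof
  show "direct_sum_decomposition (leading_grading a)" by (rule direct_sum_leading_grading)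
  show "prd b k c \<in> leading_grading a (n + m - k - 1)"
    if "b \<in> leading_grading a n" "c \<in> leading_grading a m" for b c n m k
    by (rule prd_weight_space[OF leading_0 that])
  show "vac \<in> leading_grading a 0" by (simp add: weight_space_def vacuum_right)
qed

text \<open>
  Up to a multiple of the vacuum, \<open>a\<close> differs from its component of weight two by some \<open>T z\<close>. Let
  \<open>e\<close> be the component of \<open>z\<close> of weight one in the leading grading. On the graded pieces of the
  filtration of the leading grading, \<open>a(1)\<close> induces \<open>n - e(0)\<close>. This is diagonalizable whereas
  \<open>e(0)\<close> strictly raises the degree for \<open>G\<close>, so \<open>e(0) = 0\<close>, and then \<open>e = 0\<close>.
\<close>

lemma reduced_leading_filtration:
  "a - component G a 0 \<in> filtration (leading_grading a) 2"
  "component (leading_grading a) (a - component G a 0) 2 = component G a 2"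
  "x \<in> leading_grading a n \<Longrightarrow>
    component (leading_grading a) (component (weight_space a) x n) n = x"
proof -
  let ?W = "leading_grading a" and ?E = "weight_space a" and ?a2 = "component G a 2"
  let ?r = "a - component G a 0"
  have "?r - ?a2 \<in> filtration G 3"
    using filtration_split[OF direct_sum reduced_filtration] by (simp add: component_reduced)
  moreover have "prd (?r - ?a2) 0 b = 0" for b
    using prd_reduced[of 0 b] by (simp add: prd_left(2) leading_0 A.L_minus_1)
  ultimately obtain z where z: "z \<in> filtration G 2" "?r = ?a2 + T z"
    using zero_mode_filtration[of "?r - ?a2" 3] by (auto simp: algebra_simps)
  define e where "e = component ?W z 1"
  have eG: "e \<in> filtration G 2"
    unfolding e_def by (rule filtration_component_leading_grading[OF z(1)])
  have "z \<in> filtration ?W 1"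
    using z(1) filtration_mono[OF direct_sum, of 1 2] filtration_1_leading_grading by auto
  then have Tz: "T z \<in> filtration ?W 2" by (auto simp: filtration_def W.component_T T_linear)
  have a2: "?a2 \<in> filtration ?W 2"
    by (rule filtration_homogeneous[OF W.direct_sum leading_mem_leading_grading order.refl])
  show r: "?r \<in> filtration ?W 2"
    unfolding z(2) by (rule subspace_add[OF subspace_filtration[OF W.direct_sum] a2 Tz])
  have comp: "component ?W ?r 2 = ?a2 + T e"
    by (simp add: z(2) e_def component_add[OF W.direct_sum] W.component_T
        component_homogeneous[OF W.direct_sum leading_mem_leading_grading])
  have lead: "prd a 1 v \<in> filtration ?W n"
    "component ?W (prd a 1 v) n = prd (?a2 + T e) 1 (component ?W v n)"
    if "v \<in> filtration ?W n" for v n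
    using W.prd_filtration[OF r that, of 1] W.component_prd[OF r that, of 1]
    by (simp_all add: prd_reduced comp)
  have inj: "inj (of_int :: int \<Rightarrow> 'k)" by (simp add: inj_def)
  have eigen: "component ?W (component ?E x n) n = x \<and> prd e 0 x = 0" if x: "x \<in> ?W n" for x n
  proof -
    define y where "y m = component ?W (component ?E x m) n" for m
    note L = leading_components_eigenvectors[OF W.direct_sum A.direct_sum linear_right weight_spaceD
        inj lead x]
    have yW: "y m \<in> ?W n" for m unfolding y_def by (rule component_mem[OF W.direct_sum])
    have ey: "prd e 0 (y m) = of_int (n - m) *s y m" for m
    proof -
      have "of_int n *s y m - prd e 0 (y m) = of_int m *s y m"
        using L(2)[of m] weight_spaceD[OF yW, of m] by (simp add: y_def prd_left prd_T)
      then show ?thesis by (simp add: scale_left_diff_distrib algebra_simps)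
    qed
    have y0: "y m = 0" if "m \<noteq> n" for m
    proof (rule ccontr)
      \<comment> \<open>\<open>e(0)\<close> kills the lowest component of its eigenvector \<open>y m\<close>.\<close>
      assume "y m \<noteq> 0"
      then obtain j where j: "y m \<in> filtration G j" "component G (y m) j \<noteq> 0"
        by (rule lowest_component[OF direct_sum])
      have "component G (prd e 0 (y m)) j = 0"
        using prd_filtration[OF eG j(1), of 0] by (simp add: filtration_def)
      then have "of_int (n - m) *s component G (y m) j = 0"
        by (simp only: ey component_scale[OF direct_sum])
      then show False using j(2) that by simp
    qed
    let ?M = "{m. component ?E x m \<noteq> 0}"
    have "x = (\<Sum>m\<in>?M. y m)" using L(3) by (simp add: y_def)
    also have "\<dots> = (\<Sum>m\<in>?M. if m = n then y n else 0)"
      using y0 by (intro sum.cong) auto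
    also have "\<dots> = y n"
      using finite_component[OF A.direct_sum, of x] by (auto simp: y_def component_zero[OF W.direct_sum])
    finally have "x = y n" .
    then show ?thesis using ey[of n] unfolding y_def by simp
  qed
  show "x \<in> ?W n \<Longrightarrow> component ?W (component ?E x n) n = x" using eigen by blast
  have "prd e 0 v = 0" for v
    by (subst sum_component[OF W.direct_sum, of v])
      (simp add: prd_right eigen[OF component_mem[OF W.direct_sum]])
  then obtain z' where z': "z' \<in> filtration G 1" "e = T z'"
    using zero_mode_filtration[OF eG] by auto
  have "e = component ?W e 1" unfolding e_def by (simp add: component_idem[OF W.direct_sum])
  also have "\<dots> = T (component ?W z' 0)" by (simp add: z'(2) W.component_T)
  also have "component ?W z' 0 = 0"
    using z'(1) filtration_1_leading_grading by (auto simp: filtration_def)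
  finally show "component ?W ?r 2 = ?a2" by (simp add: comp T_linear)
qed

lemma weight_space_leading_filtration:
  assumes v: "v \<in> weight_space a m"
  shows "v \<in> filtration (leading_grading a) m"
    and "component (leading_grading a) v m = 0 \<Longrightarrow> v = 0"
proof -
  let ?W = "leading_grading a"
  have *: "m = j" if j: "v \<in> filtration ?W j" "component ?W v j \<noteq> 0" for j
  proof -
    have "component ?W (prd a 1 v) j = prd (component G a 2) 1 (component ?W v j)"
      using W.component_prd[OF reduced_leading_filtration(1) j(1), of 1]
      by (simp add: prd_reduced reduced_leading_filtration(2))
    then have "of_int m *s component ?W v j = of_int j *s component ?W v j"
      using weight_spaceD[OF v] weight_spaceD[OF component_mem[OF W.direct_sum, of v j]]
      by (simp add: component_scale[OF W.direct_sum])
    then show ?thesis using j(2) by simp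
  qed
  show "v = 0" if "component ?W v m = 0"
    using * that lowest_component[OF W.direct_sum, of v] by metis
  show "v \<in> filtration ?W m"
  proof (cases "v = 0")
    case False
    then show ?thesis using * lowest_component[OF W.direct_sum, of v] by metis
  qed (simp add: subspace_0[OF subspace_filtration[OF W.direct_sum]])
qed

text \<open>
  Each weight space of \<open>a(1)\<close> lies in the corresponding step of the filtration of the leading
  grading; taking leading components is an automorphism because products respect the filtration.
\<close>

lemma ex_Aut_leading:
  "\<exists>f\<in>carrier Aut. f a = component G a 2 \<and>
    (\<forall>m x. x \<in> weight_space a m \<longrightarrow> x \<in> leading_grading a m \<longrightarrow> f x = x)"
proof -
  let ?W = "leading_grading a" and ?E = "weight_space a"
  define f where "f v = (\<Sum>m | component ?E v m \<noteq> 0. component ?W (component ?E v m) m)" for v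
  have comp: "component ?W (f v) m = component ?W (component ?E v m) m" for v m
  proof -
    have "component ?W (f v) m
        = (\<Sum>l | component ?E v l \<noteq> 0. if m = l then component ?W (component ?E v m) m else 0)"
      unfolding f_def component_sum[OF W.direct_sum] component_idem[OF W.direct_sum]
      by (intro sum.cong) auto
    then show ?thesis
      using finite_component[OF A.direct_sum, of v] by (simp add: component_zero[OF W.direct_sum])
  qed
  have hom: "f v = component ?W v m" if "v \<in> ?E m" for v m
  proof (rule eq_if_components_eq[OF W.direct_sum])
    show "component ?W (f v) n = component ?W (component ?W v m) n" for n
      by (simp add: comp component_homogeneous[OF A.direct_sum that] component_idem[OF W.direct_sum]
          component_zero[OF W.direct_sum])
  qed
  have add: "f (x + y) = f x + f y" for x y
    by (rule eq_if_components_eq[OF W.direct_sum])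
      (simp add: comp component_add[OF W.direct_sum] component_add[OF A.direct_sum])
  have scale: "f (c *s x) = c *s f x" for c x
    by (rule eq_if_components_eq[OF W.direct_sum])
      (simp add: comp component_scale[OF W.direct_sum] component_scale[OF A.direct_sum])
  interpret f: Vector_Spaces.linear scale scale f by (simp add: linear_iff' add scale)
  have mult_hom: "f (prd b n c) = prd (f b) n (f c)" if "b \<in> ?E i" "c \<in> ?E j" for b c n i j
    using W.component_prd[OF weight_space_leading_filtration(1)[OF that(1)]
        weight_space_leading_filtration(1)[OF that(2)], of n]
    by (simp add: hom[OF A.prd_degree[OF that]] hom[OF that(1)] hom[OF that(2)])
  have mult: "f (prd b n c) = prd (f b) n (f c)" for b n c
  proof -
    let ?B = "{k. component ?E b k \<noteq> 0}" and ?C = "{k. component ?E c k \<noteq> 0}"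
    have hom': "f (prd (component ?E b k) n (component ?E c l))
        = prd (f (component ?E b k)) n (f (component ?E c l))" for k l
      by (rule mult_hom[OF component_mem[OF A.direct_sum] component_mem[OF A.direct_sum]])
    have "f (prd (\<Sum>k\<in>?B. component ?E b k) n (\<Sum>k\<in>?C. component ?E c k))
        = prd (f (\<Sum>k\<in>?B. component ?E b k)) n (f (\<Sum>k\<in>?C. component ?E c k))"
      unfolding prd_left(6) by (simp add: prd_right prd_left(6) f.sum hom' sum.swap[of _ ?B])
    then show ?thesis by (simp flip: sum_component[OF A.direct_sum])
  qed
  have vac: "f vac = vac"
    using hom[OF A.vac_degree] component_homogeneous[OF W.direct_sum W.vac_degree] by simp
  have ker: "x = 0" if "f x = 0" for x
  proof (rule eq_if_components_eq[OF A.direct_sum])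
    fix m
    have "component ?W (component ?E x m) m = 0"
      using comp[of x m] that by (simp add: component_zero[OF W.direct_sum])
    then show "component ?E x m = component ?E 0 m"
      using weight_space_leading_filtration(2)[OF component_mem[OF A.direct_sum]]
      by (simp add: component_zero[OF A.direct_sum])
  qed
  have "inj f"
  proof (rule injI)
    fix x y assume "f x = f y"
    then show "x = y" using ker[of "x - y"] by (simp add: f.diff)
  qed
  moreover have "x \<in> range f" for x
  proof -
    have "f (component ?E (component ?W x n) n) = component ?W x n" for n
      using reduced_leading_filtration(3)[OF component_mem[OF W.direct_sum]]
        hom[OF component_mem[OF A.direct_sum]] by simp
    then have "f (\<Sum>n | component ?W x n \<noteq> 0. component ?E (component ?W x n) n) = x"
      by (simp add: f.sum flip: sum_component[OF W.direct_sum])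
    then show ?thesis by (rule range_eqI[OF sym])
  qed
  ultimately have f: "f \<in> carrier Aut"
    by (intro AutI add scale mult vac) (auto simp: bij_def)
  have "component G a 0 \<in> ?W 0"
    using component_0_span_vac by (auto simp: span_singleton weight_space_def vacuum_right prd_right)
  then have "component ?W (component G a 0) 2 = 0"
    by (simp add: component_homogeneous[OF W.direct_sum])
  then have "f a = component G a 2"
    using reduced_leading_filtration(2) hom[OF A.omega_degree]
    by (simp add: component_diff[OF W.direct_sum])
  moreover have "f x = x" if "x \<in> ?E m" "x \<in> ?W m" for x m
    using hom[OF that(1)] component_homogeneous[OF W.direct_sum that(2)] by simp
  ultimately show ?thesis using f by blast
qed

end

lemma ex_Aut_mem_degree_2:
  assumes "a \<in> CV_CFT"
  shows "\<exists>f\<in>carrier Aut. f a \<in> G 2"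
proof -
  obtain f where f: "f \<in> carrier Aut" "component G (f a) 1 = 0"
    using ex_Aut_component_1_zero[OF assms] by blast
  obtain g where g: "g \<in> carrier Aut" "g (f a) = component G (f a) 2"
    using ex_Aut_leading[OF CV_CFT_Aut[OF f(1) assms] f(2)] by blast
  have "(g \<circ> f) a \<in> G 2" using g(2) component_mem[OF direct_sum] by simp
  then show ?thesis using Aut_comp[OF g(1) f(1)] by blast
qed

end


section \<open>Conformal vectors of weight two\<close>

lemma (in vector_space) scale_2: "scale 2 x = x + x"
  using scale_left_distrib[of 1 1 x] by simp

context CFT_type_voa
begin

lemma omega_CV_CFT: "\<omega> \<in> CV_CFT"
proof -
  have "weight_space \<omega> = G" by (rule ext) (rule weight_space_omega)
  then show ?thesis using CFT_type_voa_axioms by (simp add: CV_CFT_def)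
qed

lemma CV_CFT_degree_2:
  assumes b: "b \<in> CV_CFT" "b \<in> G 2"
  obtains v where "v \<in> G 1" "b = \<omega> + T v"
proof -
  obtain z where z: "b = \<omega> + component G b 0 + component G b 1 + T z"
    using component_CV_CFT_difference[OF b(1)] by blast
  then have "b = \<omega> + T z" by (simp add: component_homogeneous[OF direct_sum b(2)])
  then have "component G b 2 = component G (\<omega> + T z) 2" by simp
  then have "b = \<omega> + T (component G z 1)"
    by (simp add: component_add[OF direct_sum] component_homogeneous[OF direct_sum b(2)]
        component_homogeneous[OF direct_sum omega_degree] component_T)
  then show ?thesis using that component_mem[OF direct_sum] by blast
qed

lemma CV_CFT_degree_2_prd_omega:
  assumes "b \<in> CV_CFT" "b \<in> G 2"
  shows "prd b 1 \<omega> = 2 *s \<omega>"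
proof -
  obtain v where v: "v \<in> G 1" "b = \<omega> + T v" by (rule CV_CFT_degree_2[OF assms])
  then show ?thesis
    using L0_degree[OF omega_degree] weight_one_zero_mode_omega[OF v(1)]
    by (simp add: prd_left prd_T)
qed

end

context strong_CFT_type_voa
begin

lemma L1: "v \<in> G 1 \<Longrightarrow> prd \<omega> 2 v = 0"
  using L1_degree_1[of v] by (simp add: L_def)

text \<open>
  The bilinear form \<open>u(1)v\<close> on the weight one space of a simple algebra is nondegenerate: as \<open>L(1)\<close>
  kills the weight one space, a vector \<open>u\<close> in its radical generates an ideal without components in
  degree zero.
\<close>

lemma weight_one_form_nondegenerate:
  assumes simple: simple and u: "u \<in> G 1" and form: "\<And>v. v \<in> G 1 \<Longrightarrow> prd u 1 v = 0"
  shows "u = 0"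
proof -
  have uv: "prd u (int d) v = 0" if "v \<in> G (int d)" for d v
    using that
  proof (induction d arbitrary: v)
    case 0
    then show ?case by (auto simp: degree_0 span_singleton prd_right vacuum_right)
  next
    case (Suc d)
    show ?case
    proof (cases "d = 0")
      case False
      have v: "v \<in> G (int d + 1)" using Suc.prems by (simp add: add.commute)
      have "prd u (int d) v \<in> G 1" using prd_degree[OF u v, of "int d"] by simp
      moreover have "prd \<omega> 2 v \<in> G (int d)" using prd_degree[OF omega_degree v, of 2] by simp
      ultimately have "prd (T u) (int d + 2) v + 2 *s prd u (int d + 1) v = 0"
        using commutator_2[of \<omega> u "int d" v] L1[OF u] Suc.IH
        by (simp add: L1 prd_left L_minus_1 L0_degree[OF u])
      moreover have "prd (T u) (int d + 2) v = of_int (- (int d + 2)) *s prd u (int d + 1) v"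
      proof -
        have "int d + 2 - 1 = int d + 1" by simp
        then show ?thesis by (simp only: prd_T)
      qed
      ultimately have "of_int (- int d) *s prd u (int d + 1) v = 0"
        by (simp flip: scale_left_distrib)
      then show ?thesis using False by (simp add: add.commute)
    qed (use form Suc.prems in simp)
  qed
  \<comment> \<open>For \<open>v\<close> of degree \<open>n\<close> the product \<open>v(n)u\<close> has degree zero.\<close>
  have vu: "prd v n u = 0" if "v \<in> G n" for v n
  proof (cases "n < 0")
    case False
    have "prd u (n + int i) v = 0" if "i \<ge> 1" for i
      using prd_degree[OF u \<open>v \<in> G n\<close>, of "n + int i"] that by (intro degree_neg[of _ "- int i"]) auto
    from skew_symmetry[of 1, OF this] show ?thesis
      using uv[of v "nat n"] that False by (simp add: prd_left)
  qed (use degree_neg[OF that] in \<open>simp add: prd_left\<close>)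
  define S where "S = span {prd v n u | v n. True}"
  have sub: "subspace S" unfolding S_def by (rule subspace_span)
  have left: "prd x n s \<in> S" if "s \<in> S" for x n s
    using that unfolding S_def
  proof (induction rule: span_induct_alt)
    case (step c s t)
    then show ?case
      using prd_prd_mem_span[of x n _ _ u] by (auto simp: prd_right span_add span_scale)
  qed (simp add: prd_right span_zero)
  have derivatives: "prd s (- 1 - int i) vac \<in> S" if "s \<in> S" for s i
  proof (induction i)
    case (Suc i)
    have eq: "prd s (- 1 - int (Suc i)) vac = (1 / of_nat (Suc i)) *s T (prd s (- int (Suc i)) vac)"
      using T_prd_vac[of s "int (Suc i)"] by (simp del: of_nat_Suc)
    have "- int (Suc i) = - 1 - int i" by simp
    moreover have "T (prd s (- 1 - int i) vac) \<in> S"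
      using left[OF Suc.IH, of \<omega> 0] by (simp add: L_minus_1)
    ultimately show ?case unfolding eq using sub by (simp only: subspace_scale)
  qed (simp add: creation that)
  have right: "prd s n x \<in> S" if "s \<in> S" for x n s
  proof -
    obtain N where N: "\<And>k. k \<ge> N \<Longrightarrow> prd x k s = 0" using truncation by blast
    have "prd x (n + int i) s = 0" if "i \<ge> nat (N - n)" for i using that by (intro N) linarith
    note skew = skew_symmetry[of "nat (N - n)" x n s, OF this]
    show ?thesis
      by (subst skew, assumption) (intro subspace_sum[OF sub] subspace_scale[OF sub] derivatives left[OF that])
  qed
  have "component G s 0 = 0" if "s \<in> S" for s
    using that unfolding S_def
  proof (induction rule: span_induct_alt)
    case (step c s t)
    then obtain v n where s: "s = prd v n u" by blast
    have "component G s 0 = prd (component G v n) n u"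
      using component_degree_shift[OF direct_sum linear_left[of n u], of "- n" v 0]
        prd_degree[OF _ u, of _ _ n] by (simp add: s)
    also have "\<dots> = 0" by (rule vu[OF component_mem[OF direct_sum]])
    finally show ?case using step
      by (simp add: component_add[OF direct_sum] component_scale[OF direct_sum])
  qed (simp add: component_zero[OF direct_sum])
  moreover have "S = {0} \<or> S = UNIV"
    using simple sub left right by (simp add: simple_def ideal_def)
  ultimately have "S = {0} \<or> vac = 0"
    using component_homogeneous[OF direct_sum vac_degree, of 0] by (metis UNIV_I)
  moreover have "prd vac (-1) u \<in> S" unfolding S_def by (rule span_base) blast
  ultimately show ?thesis using prd_left(4)[of "-1" u] vacuum_left[of "-1" u] by auto
qed

text \<open>
  Among the conformal vectors \<open>\<omega> + T u\<close> with \<open>u\<close> of weight one, only \<open>\<omega>\<close> is of strong CFT type.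
\<close>

lemma strong_conformal_vector_unique:
  assumes simple: simple and a: "\<omega> + T u \<in> CV_CFT" and u: "u \<in> G 1"
    and strong: "\<And>v. v \<in> weight_space (\<omega> + T u) 1 \<Longrightarrow> prd (\<omega> + T u) 2 v = 0"
  shows "u = 0"
proof (rule weight_one_form_nondegenerate[OF simple u])
  let ?a = "\<omega> + T u"
  interpret A: CFT_type_voa scale prd vac "weight_space ?a" ?a
    using a by (simp add: CV_CFT_def)
  have uu: "prd u 0 u = 0"
  proof -
    have "2 *s prd u 0 u = prd u 0 u + prd u 0 u" by (rule scale_2)
    also have "\<dots> = 0" using weight_one_bracket_antisym[OF u u] by (simp add: eq_neg_iff_add_eq_0)
    finally show ?thesis by simp
  qed
  \<comment> \<open>Strongness for \<open>?a\<close> covers the \<open>u(0)\<close>-invariants; on other eigenvectors of \<open>u(0)\<close> use invariance.\<close>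
  have hom: "prd u 1 x = 0" if x: "x \<in> G 1" "x \<in> weight_space ?a m" for x m
  proof (cases "m = 1")
    case True
    then have "prd ?a 2 x = 0" using strong x(2) by blast
    then show ?thesis using L1[OF x(1)] by (simp add: prd_left prd_T)
  next
    case False
    have "prd ?a 1 x = x - prd u 0 x" using L0_degree[OF x(1)] by (simp add: prd_left prd_T)
    then have "x - prd u 0 x = of_int m *s x" using x(2) by (simp add: weight_space_def)
    moreover have "prd u 0 x = x - (x - prd u 0 x)" by simp
    ultimately have "prd u 0 x = x - of_int m *s x" by simp
    then have ux: "prd u 0 x = of_int (1 - m) *s x" by (simp add: scale_left_diff_distrib)
    have "prd u 1 x \<in> span {vac}"
      using prd_degree[OF u x(1), of 1] by (simp add: degree_0)
    then have "prd u 0 (prd u 1 x) = 0"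
      by (auto simp: span_singleton prd_right vacuum_right)
    then have "of_int (1 - m) *s prd u 1 x = 0"
      using commutator_0[of u u 1 x] by (simp add: uu ux prd_linear)
    then show ?thesis using False by simp
  qed
  fix v assume v: "v \<in> G 1"
  have deg: "prd ?a 1 x \<in> G 1" if "x \<in> G 1" for x
    using prd_degree[OF omega_degree that, of 1] prd_degree[OF T_degree[OF u] that, of 1]
    by (simp add: prd_left subspace_add[OF subspace_summand[OF direct_sum]])
  have inj: "inj (of_int :: int \<Rightarrow> 'k)" by (simp add: inj_def)
  have "component (weight_space ?a) v m \<in> G 1" for m
    by (rule component_mem_invariant[OF A.direct_sum linear_right[of ?a 1] weight_spaceD inj
          subspace_summand[OF direct_sum] deg v])
  then have "prd u 1 (component (weight_space ?a) v m) = 0" for m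
    using hom component_mem[OF A.direct_sum] by blast
  then show "prd u 1 v = 0"
    by (subst sum_component[OF A.direct_sum, of v]) (simp add: prd_right)
qed

text \<open>
  Two conformal vectors of weight two that are conjugate under the full automorphism group are
  conjugate under the stabilizer of \<open>\<omega>\<close>: the image \<open>w\<close> of \<open>\<omega>\<close> is moved back to \<open>\<omega>\<close> by an
  automorphism that fixes \<open>b\<close>.
\<close>

lemma conjugate_fixing_omega:
  assumes simple: simple and a: "a \<in> G 2" and b: "b \<in> G 2" "b \<in> CV_CFT"
    and f: "f \<in> carrier Aut" "f a = b"
  shows "\<exists>g\<in>carrier (Aut_fixing \<omega>). g a = b"
proof -
  define w where "w = f \<omega>"
  have w: "w \<in> CV_CFT" unfolding w_def by (rule CV_CFT_Aut[OF f(1) omega_CV_CFT])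
  interpret W: CFT_type_voa scale prd vac "weight_space w" w
    using w by (simp add: CV_CFT_def)
  interpret B: CFT_type_voa scale prd vac "weight_space b" b
    using b by (simp add: CV_CFT_def)
  have bw2: "b \<in> weight_space w 2"
    using image_weight_space[OF f(1), of \<omega> 2] a f(2) by (auto simp: w_def weight_space_omega)
  have bw: "prd b 1 w = 2 *s w" by (rule W.CV_CFT_degree_2_prd_omega[OF b(2) bw2])
  obtain v where v: "v \<in> G 1" "b = \<omega> + T v" by (rule CV_CFT_degree_2[OF b(2,1)])
  have b_comp: "component G (prd b 1 x) n = prd b 1 (component G x n)" for x n
    using component_degree_shift[OF direct_sum linear_right[of b 1], of 0 x n]
      prd_degree[OF b(1), of _ _ 1] by simp
  obtain z where z: "w = \<omega> + component G w 0 + component G w 1 + T z"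
    "\<And>x. prd (component G w 1) 0 x = 0" using component_CV_CFT_difference[OF w] by blast
  define h where "h = component G w 1"
  have h: "h \<in> G 1" unfolding h_def by (rule component_mem[OF direct_sum])
  have h0: "h = 0"
  proof -
    have "prd v 0 h = 0" using weight_one_bracket_antisym[OF h v(1)] z(2) by (simp add: h_def)
    then have "prd b 1 h = h" using L0_degree[OF h] by (simp add: v(2) prd_left prd_T)
    moreover have "prd b 1 h = 2 *s h"
      using b_comp[of w 1] by (simp add: bw h_def component_scale[OF direct_sum])
    ultimately show ?thesis by (simp add: scale_2)
  qed
  obtain k where k: "k \<in> carrier Aut" "k w = component G w 2"
    "\<And>m x. x \<in> weight_space w m \<Longrightarrow> x \<in> weight_space (component G w 2) m \<Longrightarrow> k x = x"
    using ex_Aut_leading[OF w] h0 unfolding h_def by blast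
  define u where "u = component G z 1"
  have u: "u \<in> G 1" unfolding u_def by (rule component_mem[OF direct_sum])
  have w2: "component G w 2 = \<omega> + T u"
  proof -
    have "component G w 2 = component G (\<omega> + component G w 0 + component G w 1 + T z) 2"
      using z(1) by simp
    then show ?thesis
      by (simp add: u_def component_add[OF direct_sum] component_idem[OF direct_sum] component_T
          component_homogeneous[OF direct_sum omega_degree])
  qed
  have "prd b 1 u = u"
  proof -
    have "prd b 1 (\<omega> + T u) = 2 *s (\<omega> + T u)"
      using b_comp[of w 2] by (simp add: bw component_scale[OF direct_sum] flip: w2)
    then have "prd b 1 (T u) = 2 *s T u"
      using CV_CFT_degree_2_prd_omega[OF b(2,1)] by (simp add: prd_right scale_right_distrib)
    moreover have "T (prd b 1 u) = - T u + prd b 1 (T u)"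
      by (simp add: T_derivation prd_T CV_CFT_T[OF b(2)])
    ultimately have "T (prd b 1 u) = - T u + 2 *s T u" by simp
    also have "\<dots> = T u" by (simp add: scale_2)
    finally have "T (prd b 1 u - u) = 0" by (simp add: T_linear)
    moreover have "prd b 1 u - u \<in> G 1"
      using prd_degree[OF b(1) u, of 1] u
      by (simp add: subspace_diff[OF subspace_summand[OF direct_sum]])
    ultimately have "prd b 1 u - u = 0" by (rule T_inj_homogeneous) simp
    then show ?thesis by simp
  qed
  then have "prd u 0 b = 0" by (intro B.weight_one_zero_mode_omega) (simp add: weight_space_def)
  then have "b \<in> weight_space (component G w 2) 2"
    using L0_degree[OF b(1)] by (simp add: w2 weight_space_def prd_left prd_T)
  then have kb: "k b = b" by (rule k(3)[OF bw2])
  let ?g = "k \<circ> f"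
  have g: "?g \<in> carrier Aut" by (rule Aut_comp[OF k(1) f(1)])
  have g\<omega>: "?g \<omega> = \<omega> + T u" using k(2) by (simp add: w2 flip: w_def)
  have "u = 0"
  proof (rule strong_conformal_vector_unique[OF simple _ u])
    show "\<omega> + T u \<in> CV_CFT" using CV_CFT_Aut[OF g omega_CV_CFT] unfolding g\<omega> .
    fix x assume "x \<in> weight_space (\<omega> + T u) 1"
    then obtain y where y: "y \<in> G 1" "x = ?g y"
      using image_weight_space[OF g, of \<omega> 1] unfolding g\<omega> weight_space_omega by blast
    have "prd (?g \<omega>) 2 (?g y) = 0"
      using AutD(4,6)[OF g] L1[OF y(1)] by metis
    then show "prd (\<omega> + T u) 2 x = 0" unfolding g\<omega> y(2) .
  qed
  then have "?g \<omega> = \<omega>" using g\<omega> by (simp add: T_linear)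
  then have "?g \<in> carrier (Aut_fixing \<omega>)" using g by (simp add: Aut_fixing_def)
  moreover have "?g a = b" by (simp add: f(2) kb)
  ultimately show ?thesis by blast
qed

lemma bij_betw_orbits:
  assumes simple: simple
  shows "bij_betw (induced_orbit_map Aut (evaluation_action CV_CFT))
    (orbits (Aut_fixing \<omega>) (G 2 \<inter> CV_CFT) (evaluation_action (G 2 \<inter> CV_CFT)))
    (orbits Aut CV_CFT (evaluation_action CV_CFT))"
proof -
  let ?D = "G 2 \<inter> CV_CFT"
  interpret F: group_action "Aut_fixing \<omega>" ?D "evaluation_action ?D" by (rule Aut_fixing_action)
  interpret A: group_action Aut CV_CFT "evaluation_action CV_CFT" by (rule Aut_action_CV_CFT)
  let ?oF = "orbit (Aut_fixing \<omega>) (evaluation_action ?D)"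
  let ?oA = "orbit Aut (evaluation_action CV_CFT)"
  have oF: "?oF a = {f a | f. f \<in> carrier (Aut_fixing \<omega>)}" if "a \<in> ?D" for a
    using that by (simp add: orbit_def evaluation_action_def)
  have oA: "?oA a = {f a | f. f \<in> carrier Aut}" if "a \<in> CV_CFT" for a
    using that by (simp add: orbit_def evaluation_action_def)
  have inj: "?oF a = ?oF b" if ab: "a \<in> ?D" "b \<in> ?D" and eq: "?oA a = ?oA b" for a b
  proof -
    have "b \<in> ?oA a" using A.orbit_refl[of b] ab(2) eq by simp
    then obtain f where f: "f \<in> carrier Aut" "f a = b" using oA[of a] ab(1) by auto
    obtain g where "g \<in> carrier (Aut_fixing \<omega>)" "g a = b"
      using conjugate_fixing_omega[OF simple _ _ _ f] ab by blast
    then have "b \<in> ?oF a" using oF[OF ab(1)] by blast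
    moreover have "b \<in> ?oF b" by (rule F.orbit_refl[OF ab(2)])
    moreover have "?oF a \<in> orbits (Aut_fixing \<omega>) ?D (evaluation_action ?D)"
      "?oF b \<in> orbits (Aut_fixing \<omega>) ?D (evaluation_action ?D)"
      using ab by (auto simp: orbits_def)
    ultimately show ?thesis using F.disjoint_union by blast
  qed
  have surj: "\<exists>b\<in>?D. ?oA b = ?oA a" if a: "a \<in> CV_CFT" for a
  proof -
    obtain f where f: "f \<in> carrier Aut" "f a \<in> G 2" using ex_Aut_mem_degree_2[OF a] by blast
    have b: "f a \<in> CV_CFT" by (rule CV_CFT_Aut[OF f(1) a])
    have "f a \<in> ?oA a" using oA[OF a] f(1) by blast
    moreover have "f a \<in> ?oA (f a)" by (rule A.orbit_refl[OF b])
    moreover have "?oA a \<in> orbits Aut CV_CFT (evaluation_action CV_CFT)"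
      "?oA (f a) \<in> orbits Aut CV_CFT (evaluation_action CV_CFT)"
      using a b by (auto simp: orbits_def)
    ultimately have "?oA (f a) = ?oA a" using A.disjoint_union by blast
    then show ?thesis using b f(2) by blast
  qed
  show ?thesis
  proof (rule bij_betw_imageI)
    show "inj_on (induced_orbit_map Aut (evaluation_action CV_CFT))
        (orbits (Aut_fixing \<omega>) ?D (evaluation_action ?D))"
    proof (rule inj_onI)
      fix X Y assume "X \<in> orbits (Aut_fixing \<omega>) ?D (evaluation_action ?D)"
        and "Y \<in> orbits (Aut_fixing \<omega>) ?D (evaluation_action ?D)"
      then obtain a b where ab: "a \<in> ?D" "X = ?oF a" "b \<in> ?D" "Y = ?oF b"
        by (auto simp: orbits_def)
      assume "induced_orbit_map Aut (evaluation_action CV_CFT) X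
        = induced_orbit_map Aut (evaluation_action CV_CFT) Y"
      then have "?oA a = ?oA b" using ab by (simp only: induced_orbit_map_orbit)
      then have "?oF a = ?oF b" by (rule inj[OF ab(1,3)])
      then show "X = Y" unfolding ab(2,4) .
    qed
    have "induced_orbit_map Aut (evaluation_action CV_CFT)
          ` orbits (Aut_fixing \<omega>) ?D (evaluation_action ?D) = ?oA ` ?D"
    proof -
      have "orbits (Aut_fixing \<omega>) ?D (evaluation_action ?D) = ?oF ` ?D"
        by (auto simp: orbits_def)
      then show ?thesis by (simp add: image_image induced_orbit_map_orbit)
    qed
    also have "\<dots> = ?oA ` CV_CFT"
    proof
      show "?oA ` CV_CFT \<subseteq> ?oA ` ?D"
      proof
        fix X assume "X \<in> ?oA ` CV_CFT"
        then obtain a where "a \<in> CV_CFT" "X = ?oA a" by blast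
        then show "X \<in> ?oA ` ?D" using surj[of a] by (metis image_eqI)
      qed
    qed blast
    also have "\<dots> = orbits Aut CV_CFT (evaluation_action CV_CFT)" by (auto simp: orbits_def)
    finally show "induced_orbit_map Aut (evaluation_action CV_CFT)
          ` orbits (Aut_fixing \<omega>) ?D (evaluation_action ?D)
        = orbits Aut CV_CFT (evaluation_action CV_CFT)" .
  qed
qed

end

theorem theorem6p2:
  fixes scale_real :: "real \<Rightarrow> 'v::ab_group_add \<Rightarrow> 'v"
    and scale_complex :: "complex \<Rightarrow> 'v \<Rightarrow> 'v"
    and prd :: "'v \<Rightarrow> int \<Rightarrow> 'v \<Rightarrow> 'v"
    and vac \<omega> :: 'v
    and G :: "int \<Rightarrow> 'v set"
  shows
    "(strong_CFT_type_voa scale_real prd vac G \<omega> \<and> vertex_algebra.simple scale_real prd \<longrightarrow>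
       (let Aut_V = vertex_algebra.Aut scale_real prd vac;
            Aut_\<omega>_V = vertex_algebra.Aut_fixing scale_real prd vac \<omega>;
            CV = vertex_algebra.CV_CFT scale_real prd vac
        in bij_betw (induced_orbit_map Aut_V (evaluation_action CV))
             (orbits Aut_\<omega>_V (G 2 \<inter> CV) (evaluation_action (G 2 \<inter> CV)))
             (orbits Aut_V CV (evaluation_action CV))))
     \<and>
     (strong_CFT_type_voa scale_complex prd vac G \<omega> \<and> vertex_algebra.simple scale_complex prd \<longrightarrow>
       (let Aut_V = vertex_algebra.Aut scale_complex prd vac;
            Aut_\<omega>_V = vertex_algebra.Aut_fixing scale_complex prd vac \<omega>;
            CV = vertex_algebra.CV_CFT scale_complex prd vac
        in bij_betw (induced_orbit_map Aut_V (evaluation_action CV))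
             (orbits Aut_\<omega>_V (G 2 \<inter> CV) (evaluation_action (G 2 \<inter> CV)))
             (orbits Aut_V CV (evaluation_action CV))))"
proof (intro conjI impI)
  assume "strong_CFT_type_voa scale_real prd vac G \<omega> \<and> vertex_algebra.simple scale_real prd"
  then show "let Aut_V = vertex_algebra.Aut scale_real prd vac;
            Aut_\<omega>_V = vertex_algebra.Aut_fixing scale_real prd vac \<omega>;
            CV = vertex_algebra.CV_CFT scale_real prd vac
        in bij_betw (induced_orbit_map Aut_V (evaluation_action CV))
             (orbits Aut_\<omega>_V (G 2 \<inter> CV) (evaluation_action (G 2 \<inter> CV)))
             (orbits Aut_V CV (evaluation_action CV))"
    unfolding Let_def by (blast intro: strong_CFT_type_voa.bij_betw_orbits)
next
  assume "strong_CFT_type_voa scale_complex prd vac G \<omega> \<and> vertex_algebra.simple scale_complex prd"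
  then show "let Aut_V = vertex_algebra.Aut scale_complex prd vac;
            Aut_\<omega>_V = vertex_algebra.Aut_fixing scale_complex prd vac \<omega>;
            CV = vertex_algebra.CV_CFT scale_complex prd vac
        in bij_betw (induced_orbit_map Aut_V (evaluation_action CV))
             (orbits Aut_\<omega>_V (G 2 \<inter> CV) (evaluation_action (G 2 \<inter> CV)))
             (orbits Aut_V CV (evaluation_action CV))"
    unfolding Let_def by (blast intro: strong_CFT_type_voa.bij_betw_orbits)
qed

end
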